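(* Let $X$ be a Polish space, $\Gamma$ a countable group acting on $X$ in a Borel way, and let $G$ be an analytic $\Gamma$-invariant graph on $X$ which is a subset of the orbit equivalence relation. Let $I$ be the $\sigma$-ideal on $X$ $\sigma$-generated by Borel $G$-anticliques. Let $A\subset X$ be an analytic set. Exactly one of the following occurs: (1) $A\in I$; (2) there is a continuous injective function $h\colon 2^\omega\to A$ which is a homomorphism of the Silver graph to $G$.
   Context: A graph is a symmetric irreflexive binary relation. A $G$-anticlique is a set containing no two $G$-connected points. $G$ is $\Gamma$-invariant if $\langle x,y\rangle\in G$ implies $\langle\gamma\cdot x,\gamma\cdot y\rangle\in G$ for every $\gamma\in\Gamma$. The Silver graph is the graph on $2^\omega$ connecting points $x,y$ just in case they disagree on exactly one entry. A map $h$ is a homomorphism of a graph $S$ to a graph $G$ if $\langle x,y\rangle\in S$ implies $\langle h(x),h(y)\rangle\in G$. *)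

theory Defs
  imports "HOL-Analysis.Analysis" "HOL-Algebra.Group_Action"
begin

text \<open>
  Analytic sets are continuous images of the Baire space, together with the empty set.
\<close>
definition analytic_set :: "'a::topological_space set \<Rightarrow> bool" where
  "analytic_set A \<longleftrightarrow>
     A = {} \<or> (\<exists>f :: (nat \<Rightarrow> nat) \<Rightarrow> 'a. continuous_on UNIV f \<and> range f = A)"

definition graph_relation :: "('a \<times> 'a) set \<Rightarrow> bool" where
  "graph_relation G \<longleftrightarrow> sym G \<and> irrefl G"

definition anticlique :: "('a \<times> 'a) set \<Rightarrow> 'a set \<Rightarrow> bool" where
  "anticlique G C \<longleftrightarrow> (\<forall>x\<in>C. \<forall>y\<in>C. (x, y) \<notin> G)"

definition graph_homomorphism ::
    "('a \<times> 'a) set \<Rightarrow> ('b \<times> 'b) set \<Rightarrow> ('a \<Rightarrow> 'b) \<Rightarrow> bool" where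
  "graph_homomorphism S G h \<longleftrightarrow> (\<forall>x y. (x, y) \<in> S \<longrightarrow> (h x, h y) \<in> G)"

text \<open>
  The space of infinite binary sequences is the type of functions from \<^typ>\<open>nat\<close>
  to \<^typ>\<open>bool\<close>; its library topology is the product of the discrete ones.
\<close>
definition silver_graph :: "((nat \<Rightarrow> bool) \<times> (nat \<Rightarrow> bool)) set" where
  "silver_graph = {(x, y). \<exists>!n. x n \<noteq> y n}"

text \<open>
  Joint measurability of the action, where the countable group carries the discrete
  Borel structure.
\<close>
definition borel_group_action ::
    "('g, 'm) monoid_scheme \<Rightarrow> ('g \<Rightarrow> 'a \<Rightarrow> 'a::topological_space) \<Rightarrow> bool" where
  "borel_group_action \<Gamma> act \<longleftrightarrow>
     group_action \<Gamma> UNIV act \<and>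
     (\<lambda>(\<gamma>, x). act \<gamma> x) \<in> count_space (carrier \<Gamma>) \<Otimes>\<^sub>M borel \<rightarrow>\<^sub>M borel"

definition orbit_equivalence ::
    "('g, 'm) monoid_scheme \<Rightarrow> ('g \<Rightarrow> 'a \<Rightarrow> 'a) \<Rightarrow> ('a \<times> 'a) set" where
  "orbit_equivalence \<Gamma> act = {(x, y). y \<in> orbit \<Gamma> act x}"

definition invariant_graph ::
    "('g, 'm) monoid_scheme \<Rightarrow> ('g \<Rightarrow> 'a \<Rightarrow> 'a) \<Rightarrow> ('a \<times> 'a) set \<Rightarrow> bool" where
  "invariant_graph \<Gamma> act G \<longleftrightarrow>
     (\<forall>x y. (x, y) \<in> G \<longrightarrow> (\<forall>\<gamma>\<in>carrier \<Gamma>. (act \<gamma> x, act \<gamma> y) \<in> G))"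

text \<open>The ideal is not required to be proper: the whole space may belong to it.\<close>
definition sigma_ideal :: "'a set set \<Rightarrow> bool" where
  "sigma_ideal I \<longleftrightarrow>
     {} \<in> I \<and>
     (\<forall>A\<in>I. \<forall>B. B \<subseteq> A \<longrightarrow> B \<in> I) \<and>
     (\<forall>F. countable F \<and> F \<subseteq> I \<longrightarrow> \<Union>F \<in> I)"

definition anticlique_ideal :: "('a::topological_space \<times> 'a) set \<Rightarrow> 'a set set" where
  "anticlique_ideal G = sigma_ideal hull {C. C \<in> sets borel \<and> anticlique G C}"

lemma mem_sigma_ideal_hull_iff:
  "A \<in> sigma_ideal hull \<B> \<longleftrightarrow> (\<exists>F. countable F \<and> F \<subseteq> \<B> \<and> A \<subseteq> \<Union>F)"
proof
  define J where "J = {A. \<exists>F. countable F \<and> F \<subseteq> \<B> \<and> A \<subseteq> \<Union>F}"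
  have J: "A \<in> J \<longleftrightarrow> (\<exists>F. countable F \<and> F \<subseteq> \<B> \<and> A \<subseteq> \<Union>F)" for A
    by (simp add: J_def)
  have un: "\<Union>F \<in> J" if F: "countable F" "F \<subseteq> J" for F
  proof -
    from F(2) have "\<forall>B\<in>F. \<exists>H. countable H \<and> H \<subseteq> \<B> \<and> B \<subseteq> \<Union>H" using J by auto
    from bchoice[OF this] obtain H
      where H: "\<forall>B\<in>F. countable (H B) \<and> H B \<subseteq> \<B> \<and> B \<subseteq> \<Union>(H B)" ..
    have "countable (\<Union>(H ` F))" using F(1) H by simp
    moreover have "\<Union>(H ` F) \<subseteq> \<B>" using H by (simp add: UN_subset_iff)
    moreover have "\<Union>F \<subseteq> \<Union>(\<Union>(H ` F))"
    proof
      fix x assume "x \<in> \<Union>F"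
      then obtain B where B: "B \<in> F" "x \<in> B" by (rule UnionE)
      with H have "x \<in> \<Union>(H B)" by (meson subsetD)
      with B(1) show "x \<in> \<Union>(\<Union>(H ` F))" by auto
    qed
    ultimately show ?thesis unfolding J by (intro exI[of _ "\<Union>(H ` F)"] conjI)
  qed
  have sub: "\<B> \<subseteq> J"
  proof
    fix B assume "B \<in> \<B>"
    then show "B \<in> J" unfolding J by (intro exI[of _ "{B}"]) simp
  qed
  have "{} \<in> J" unfolding J by (intro exI[of _ "{}"]) simp
  moreover have "B \<in> J" if "A \<in> J" "B \<subseteq> A" for A B
    using that unfolding J by (meson subset_trans)
  ultimately have "sigma_ideal J"
    unfolding sigma_ideal_def using un by simp
  then have "sigma_ideal hull \<B> \<subseteq> J" using sub by (simp add: hull_minimal)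
  then show "A \<in> sigma_ideal hull \<B> \<Longrightarrow> \<exists>F. countable F \<and> F \<subseteq> \<B> \<and> A \<subseteq> \<Union>F"
    using J by auto
next
  assume "\<exists>F. countable F \<and> F \<subseteq> \<B> \<and> A \<subseteq> \<Union>F"
  then obtain F where F: "countable F" "F \<subseteq> \<B>" "A \<subseteq> \<Union>F" by auto
  have "A \<in> I" if I: "sigma_ideal I" "\<B> \<subseteq> I" for I
  proof -
    have "F \<subseteq> I" using F(2) I(2) by simp
    then have "\<Union>F \<in> I" using I(1) F(1) by (simp add: sigma_ideal_def)
    then show ?thesis using I(1) F(3) by (simp add: sigma_ideal_def)
  qed
  then show "A \<in> sigma_ideal hull \<B>" by (simp add: hull_def)
qed

end

theory Submission
  imports Defs
begin

text \<open>
  For the dichotomy, shrink \<open>A\<close> through sets \<open>E\<^sub>0 \<supseteq> E\<^sub>1 \<supseteq> \<dots>\<close> outside the ideal and pick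
  \<open>\<gamma>\<^sub>0, \<gamma>\<^sub>1, \<dots>\<close> in the group so that every \<open>a \<in> E\<^sub>n\<^sub>+\<^sub>1\<close> satisfies \<open>\<gamma>\<^sub>n a \<in> E\<^sub>n\<close> and \<open>(a, \<gamma>\<^sub>n a) \<in> G\<close>.
  If no \<open>\<gamma>\<^sub>n\<close> works then, since \<open>G\<close> lives on orbits, \<open>E\<^sub>n\<close> is up to a set in the ideal an analytic
  anticlique, and two applications of Lusin separation put this inside a Borel anticlique.
  The points \<open>\<gamma>\<^sub>s a = \<gamma>\<^sub>0\<^bsup>s(0)\<^esup> \<cdots> \<gamma>\<^sub>n\<^sub>-\<^sub>1\<^bsup>s(n-1)\<^esup> a\<close> with \<open>a \<in> E\<^sub>n\<close> then lie in \<open>A\<close>, and by invariance of \<open>G\<close> strings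
  \<open>s\<close>, \<open>t\<close> differing in one place give \<open>G\<close>-related points.  The map \<open>h(x)\<close> is the limit of \<open>\<gamma>\<^sub>s a\<close> over the
  restrictions \<open>s\<close> of \<open>x\<close>.  The action need not be continuous: at stage \<open>n\<close> one also fixes
  longer and longer initial segments of codes witnessing membership in \<open>A\<close> and in \<open>G\<close> with respect to
  continuous surjections from the Baire space, and the codes, hence the points, converge.

  The alternatives exclude each other because a Borel set that is not meager contains points
  differing in exactly one entry.
\<close>

subsection \<open>Cylinders in the Baire space\<close>

definition cylinder :: "nat list \<Rightarrow> (nat \<Rightarrow> nat) set" where
  "cylinder u = {b. \<forall>i<length u. b i = u ! i}"

lemma cylinder_Nil [simp]: "cylinder [] = UNIV"
  by (simp add: cylinder_def)

lemma mem_cylinder_prefix: "b \<in> cylinder (map b [0..<n])"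
  by (simp add: cylinder_def)

lemma cylinder_nonempty: "\<exists>b. b \<in> cylinder u"
  by (intro exI[of _ "\<lambda>i. u ! i"]) (simp add: cylinder_def)

lemma cylinder_prefix_subset:
  assumes "b \<in> cylinder u" and "length u \<le> n"
  shows "cylinder (map b [0..<n]) \<subseteq> cylinder u"
  using assms by (auto simp: cylinder_def)

lemma closed_cylinder: "closed (cylinder u)"
proof -
  have "cylinder u = (\<Inter>i\<in>{..<length u}. (\<lambda>b. b i) -` {u ! i})"
    by (auto simp: cylinder_def)
  moreover have "closed ((\<lambda>b :: nat \<Rightarrow> nat. b i) -` {u ! i})" for i
    by (intro closed_vimage continuous_on_product_coordinates) (simp add: closed_def open_discrete)
  ultimately show ?thesis
    by (simp add: closed_INT)
qed

lemma cylinder_UN_snoc: "cylinder u = (\<Union>k. cylinder (u @ [k]))"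
  by (auto simp: cylinder_def nth_append less_Suc_eq)

lemma tendsto_fun_componentwise:
  fixes c :: "'i \<Rightarrow> 'j \<Rightarrow> 'b::topological_space"
  assumes "\<And>j. ((\<lambda>i. c i j) \<longlongrightarrow> b j) F"
  shows "(c \<longlongrightarrow> b) F"
proof -
  have "limitin (product_topology (\<lambda>_. euclidean) UNIV) c b F"
    using assms by (simp add: limitin_componentwise)
  then show ?thesis
    by (simp add: euclidean_product_topology)
qed

text \<open>If every cylinder around \<open>b\<close> left \<open>U\<close>, points
  \<open>c n\<close> outside \<open>U\<close> agreeing with \<open>b\<close> below \<open>n\<close>
  would converge to \<open>b\<close>.\<close>

lemma open_contains_cylinder:
  assumes "open U" and "b \<in> U"
  obtains n where "cylinder (map b [0..<n]) \<subseteq> U"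
proof (rule ccontr)
  assume "\<not> thesis"
  then have "\<forall>n. \<exists>c. c \<in> cylinder (map b [0..<n]) \<and> c \<notin> U"
    using that by blast
  then obtain c where c: "\<And>n. c n \<in> cylinder (map b [0..<n])" "\<And>n. c n \<notin> U"
    by metis
  have "(\<lambda>n. c n i) \<longlonglongrightarrow> b i" for i
    using c(1) by (intro tendsto_eventually eventually_sequentiallyI[of "Suc i"]) (simp add: cylinder_def)
  then have "c \<longlonglongrightarrow> b"
    by (rule tendsto_fun_componentwise)
  then have "eventually (\<lambda>n. c n \<in> U) sequentially"
    using assms by (rule topological_tendstoD)
  then show False
    using c(2) by simp
qed

text \<open>The growing strings decide every coordinate, so they determine one point. The second
  conclusion applies to arbitrary selections from the cylinders; it later makes codes chosen
  separately at each stage converge.\<close>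

lemma nested_cylinders:
  assumes len: "\<And>n. n \<le> length (u n)" and nest: "\<And>n. cylinder (u (Suc n)) \<subseteq> cylinder (u n)"
  obtains b where "\<And>n. b \<in> cylinder (u n)"
    and "\<And>c. (\<And>n. c n \<in> cylinder (u n)) \<Longrightarrow> c \<longlonglongrightarrow> b"
proof
  \<comment> \<open>Entry \<open>i\<close> is read from \<open>u (Suc i)\<close>, whose length is at
    least \<open>i + 1\<close>.\<close>
  let ?b = "\<lambda>i. u (Suc i) ! i"
  have mono: "cylinder (u m) \<subseteq> cylinder (u n)" if "n \<le> m" for m n
    using nest that by (rule lift_Suc_antimono_le)
  have agree: "c i = ?b i" if "c \<in> cylinder (u m)" "Suc i \<le> m" for c m i
  proof -
    have "c \<in> cylinder (u (Suc i))"
      using mono[OF that(2)] that(1) by blast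
    then show ?thesis
      using len[of "Suc i"] by (simp add: cylinder_def)
  qed
  show "?b \<in> cylinder (u n)" for n
    unfolding cylinder_def
  proof (intro CollectI allI impI)
    fix i assume i: "i < length (u n)"
    obtain c where c: "c \<in> cylinder (u (max n (Suc i)))"
      using cylinder_nonempty by blast
    then have "c \<in> cylinder (u n)"
      using mono[of n "max n (Suc i)"] by auto
    then show "?b i = u n ! i"
      using i agree[OF c, of i] by (simp add: cylinder_def)
  qed
  show "c \<longlonglongrightarrow> ?b" if "\<And>n. c n \<in> cylinder (u n)" for c
  proof -
    have "(\<lambda>n. c n i) \<longlonglongrightarrow> ?b i" for i
      by (rule tendsto_eventually) (auto intro!: eventually_sequentiallyI[of "Suc i"] agree[OF that])
    then show ?thesis
      by (rule tendsto_fun_componentwise)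
  qed
qed

subsection \<open>Projections of closed sets\<close>

text \<open>Splitting into even and odd entries is a continuous surjection onto the square of the
  Baire space; it lets a single code carry two.\<close>

definition unpair :: "(nat \<Rightarrow> nat) \<Rightarrow> (nat \<Rightarrow> nat) \<times> (nat \<Rightarrow> nat)" where
  "unpair b = (\<lambda>n. b (2 * n), \<lambda>n. b (2 * n + 1))"

lemma continuous_unpair: "continuous_on S unpair"
  unfolding unpair_def
  by (intro continuous_on_Pair continuous_on_coordinatewise_then_product
        continuous_on_subset[OF continuous_on_product_coordinates]) auto

lemma surj_unpair: "surj unpair"
proof (rule surjI)
  fix p
  show "unpair (\<lambda>n. if even n then fst p (n div 2) else snd p (n div 2)) = p"
    by (cases p) (simp add: unpair_def)
qed

text \<open>The classical form of analytic sets as projections of closed sets. The extra coordinate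
  has room for countable unions and intersections.\<close>

definition closed_projection :: "'a::topological_space set \<Rightarrow> bool" where
  "closed_projection B \<longleftrightarrow> (\<exists>C :: ('a \<times> (nat \<Rightarrow> nat)) set. closed C \<and> B = fst ` C)"

lemma closed_projection_closed:
  assumes "closed B"
  shows "closed_projection B"
proof -
  have "closed (B \<times> (UNIV :: (nat \<Rightarrow> nat) set))"
    using assms by (intro closed_Times) auto
  then show ?thesis
    unfolding closed_projection_def by (intro exI[of _ "B \<times> UNIV"]) auto
qed

lemma closed_projection_UN:
  fixes B :: "nat \<Rightarrow> 'a::topological_space set"
  assumes "\<And>n. closed_projection (B n)"
  shows "closed_projection (\<Union>n. B n)"
proof -
  have "\<forall>n. \<exists>C :: ('a \<times> (nat \<Rightarrow> nat)) set. closed C \<and> B n = fst ` C"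
    using assms unfolding closed_projection_def by simp
  then obtain C :: "nat \<Rightarrow> ('a \<times> (nat \<Rightarrow> nat)) set"
    where C: "\<And>n. closed (C n)" "\<And>n. B n = fst ` C n"
    by (auto dest!: choice)
  let ?T = "\<lambda>p :: 'a \<times> (nat \<Rightarrow> nat). (fst p, \<lambda>n. snd p (Suc n))"
  \<comment> \<open>The first entry of the code names the index \<open>n\<close> and the tail is a
    witness for \<open>C n\<close>. Written as an intersection of implications with clopen premises,
    the set is visibly closed, although it encodes an infinite union.\<close>
  let ?D = "\<Inter>n. {p. snd p 0 \<noteq> n} \<union> ?T -` C n"
  have cont: "continuous_on UNIV (\<lambda>p :: 'a \<times> (nat \<Rightarrow> nat). snd p i)" for i
    by (rule continuous_on_compose2[OF continuous_on_product_coordinates]) (auto intro: continuous_intros)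
  have "closed {p :: 'a \<times> (nat \<Rightarrow> nat). snd p 0 \<noteq> n}" for n
    using closed_vimage[OF _ cont, of "- {n}" 0] by (simp add: vimage_def closed_def open_discrete)
  moreover have "continuous_on UNIV ?T"
    by (intro continuous_on_Pair continuous_on_coordinatewise_then_product cont continuous_intros)
  ultimately have "closed ?D"
    by (intro closed_INT closed_Un ballI closed_vimage C) auto
  moreover have "(\<Union>n. B n) = fst ` ?D"
  proof (intro equalityI subsetI)
    fix x assume "x \<in> (\<Union>n. B n)"
    then obtain n b where "(x, b) \<in> C n"
      using C(2) by force
    then have "(x, case_nat n b) \<in> ?D"
      by auto
    then show "x \<in> fst ` ?D"
      by (rule image_eqI[rotated]) simp
  next
    fix x assume "x \<in> fst ` ?D"
    then obtain b where "(x, b) \<in> ?D"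
      by auto
    then have "(x, \<lambda>n. b (Suc n)) \<in> C (b 0)"
      by auto
    then show "x \<in> (\<Union>n. B n)"
      using C(2) by force
  qed
  ultimately show ?thesis
    unfolding closed_projection_def by blast
qed

lemma closed_projection_INT:
  fixes B :: "nat \<Rightarrow> 'a::topological_space set"
  assumes "\<And>n. closed_projection (B n)"
  shows "closed_projection (\<Inter>n. B n)"
proof -
  have "\<forall>n. \<exists>C :: ('a \<times> (nat \<Rightarrow> nat)) set. closed C \<and> B n = fst ` C"
    using assms unfolding closed_projection_def by simp
  then obtain C :: "nat \<Rightarrow> ('a \<times> (nat \<Rightarrow> nat)) set"
    where C: "\<And>n. closed (C n)" "\<And>n. B n = fst ` C n"
    by (auto dest!: choice)
  \<comment> \<open>One code holds a whole sequence of codes, the \<open>n\<close>-th of them stored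
    at the positions \<open>prod_encode (n, k)\<close>.\<close>
  let ?T = "\<lambda>n (p :: 'a \<times> (nat \<Rightarrow> nat)). (fst p, \<lambda>k. snd p (prod_encode (n, k)))"
  let ?D = "\<Inter>n. ?T n -` C n"
  have cont: "continuous_on UNIV (\<lambda>p :: 'a \<times> (nat \<Rightarrow> nat). snd p i)" for i
    by (rule continuous_on_compose2[OF continuous_on_product_coordinates]) (auto intro: continuous_intros)
  have "continuous_on UNIV (?T n)" for n
    by (intro continuous_on_Pair continuous_on_coordinatewise_then_product cont continuous_intros)
  then have "closed ?D"
    by (intro closed_INT ballI closed_vimage C)
  moreover have "(\<Inter>n. B n) = fst ` ?D"
  proof (intro equalityI subsetI)
    fix x assume "x \<in> (\<Inter>n. B n)"
    then have "\<forall>n. \<exists>b. (x, b) \<in> C n"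
      using C(2) by force
    then obtain b where "\<And>n. (x, b n) \<in> C n"
      by metis
    then have "(x, \<lambda>k. case prod_decode k of (n, i) \<Rightarrow> b n i) \<in> ?D"
      by simp
    then show "x \<in> fst ` ?D"
      by (rule image_eqI[rotated]) simp
  next
    fix x assume "x \<in> fst ` ?D"
    then show "x \<in> (\<Inter>n. B n)"
      using C(2) by force
  qed
  ultimately show ?thesis
    unfolding closed_projection_def by blast
qed

text \<open>There are only countably many cylinders, each of them closed, and those contained in
  \<open>U\<close> cover it.\<close>

lemma closed_projection_open:
  fixes U :: "(nat \<Rightarrow> nat) set"
  assumes "open U"
  shows "closed_projection U"
proof -
  let ?K = "\<lambda>n. if cylinder (from_nat n) \<subseteq> U then cylinder (from_nat n) else {}"
  have "closed_projection (\<Union>n. ?K n)"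
    by (intro closed_projection_UN closed_projection_closed) (simp add: closed_cylinder)
  moreover have "(\<Union>n. ?K n) = U"
  proof (intro equalityI subsetI)
    fix b assume "b \<in> U"
    then obtain n where "cylinder (map b [0..<n]) \<subseteq> U"
      using assms open_contains_cylinder by blast
    then have "b \<in> ?K (to_nat (map b [0..<n]))"
      by (simp add: mem_cylinder_prefix)
    then show "b \<in> (\<Union>n. ?K n)"
      by blast
  qed (auto split: if_splits)
  ultimately show ?thesis by simp
qed

lemma borel_closed_projection:
  fixes B :: "(nat \<Rightarrow> nat) set"
  assumes "B \<in> sets borel"
  shows "closed_projection B"
proof -
  have "B \<in> sigma_sets UNIV {S. open S}"
    using assms by (simp add: sets_borel)
  \<comment> \<open>The complement is carried through the induction, since closed projections are
    not stable under complements; unions and intersections then exchange roles.\<close>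
  then have "closed_projection B \<and> closed_projection (- B)"
  proof induction
    case (Basic S)
    then show ?case
      by (simp add: closed_projection_open closed_projection_closed closed_Compl)
  next
    case Empty
    then show ?case
      by (simp add: closed_projection_closed)
  next
    case (Compl S)
    then show ?case
      by (simp add: Compl_eq_Diff_UNIV[symmetric])
  next
    case (Union S)
    then show ?case
      by (auto intro: closed_projection_UN closed_projection_INT)
  qed
  then show ?thesis ..
qed

definition borel_image :: "'a::topological_space set \<Rightarrow> bool" where
  "borel_image E \<longleftrightarrow>
     (\<exists>(f :: (nat \<Rightarrow> nat) \<Rightarrow> 'a) B. continuous_on UNIV f \<and> B \<in> sets borel \<and> E = f ` B)"

lemma borel_image_pair:
  fixes f :: "(nat \<Rightarrow> nat) \<times> (nat \<Rightarrow> nat) \<Rightarrow> 'a::topological_space"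
  assumes "continuous_on UNIV f" and "B \<in> sets borel"
  shows "borel_image (f ` B)"
  unfolding borel_image_def
proof (intro exI conjI)
  show "continuous_on UNIV (\<lambda>b. f (unpair b))"
    by (rule continuous_on_compose2[OF assms(1) continuous_unpair]) simp
  have "unpair \<in> borel_measurable borel"
    by (rule borel_measurable_continuous_onI[OF continuous_unpair])
  then show "unpair -` B \<in> sets borel"
    using assms(2) by (rule measurable_sets_borel)
  have "B = unpair ` (unpair -` B)"
    using surj_unpair by (simp add: surj_image_vimage_eq)
  then show "f ` B = (\<lambda>b. f (unpair b)) ` (unpair -` B)"
    by (metis image_image)
qed

text \<open>The Borel set of codes is itself the projection of a closed set, and
  \<open>unpair\<close> absorbs the extra coordinate. Closedness keeps limits of codes inside the
  code set in the separation argument.\<close>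

lemma borel_image_closed:
  fixes E :: "'a::topological_space set"
  assumes "borel_image E"
  obtains f :: "(nat \<Rightarrow> nat) \<Rightarrow> 'a" and D
  where "continuous_on UNIV f" "closed D" "E = f ` D"
proof -
  obtain f :: "(nat \<Rightarrow> nat) \<Rightarrow> 'a" and B
    where f: "continuous_on UNIV f" and "B \<in> sets borel" and E: "E = f ` B"
    using assms unfolding borel_image_def by blast
  then have "closed_projection B"
    by (intro borel_closed_projection)
  then obtain C :: "((nat \<Rightarrow> nat) \<times> (nat \<Rightarrow> nat)) set" where C: "closed C" "B = fst ` C"
    unfolding closed_projection_def by (elim exE conjE)
  show thesis
  proof (rule that)
    show "continuous_on UNIV (\<lambda>b. f (fst (unpair b)))"
      by (rule continuous_on_compose2[OF f]) (auto intro: continuous_intros continuous_unpair)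
    show "closed (unpair -` C)"
      using C(1) continuous_unpair by (rule closed_vimage)
    have "C = unpair ` (unpair -` C)"
      using surj_unpair by (simp add: surj_image_vimage_eq)
    then show "E = (\<lambda>b. f (fst (unpair b))) ` (unpair -` C)"
      unfolding E C(2) by (metis image_image)
  qed
qed

subsection \<open>Lusin separation\<close>

definition borel_separated :: "'a::topological_space set \<Rightarrow> 'a set \<Rightarrow> bool" where
  "borel_separated P Q \<longleftrightarrow> (\<exists>B\<in>sets borel. P \<subseteq> B \<and> Q \<inter> B = {})"

text \<open>The union over \<open>k\<close> of the intersections over \<open>l\<close> of the given
  separators works. Read contrapositively, inseparability passes to some pair of pieces.\<close>

lemma borel_separated_UN:
  fixes P Q :: "nat \<Rightarrow> 'a::topological_space set"
  assumes "\<And>k l. borel_separated (P k) (Q l)"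
  shows "borel_separated (\<Union>k. P k) (\<Union>l. Q l)"
proof -
  have "\<forall>k l. \<exists>B\<in>sets borel. P k \<subseteq> B \<and> Q l \<inter> B = {}"
    using assms unfolding borel_separated_def by blast
  then obtain B where "\<And>k l. B k l \<in> sets borel \<and> P k \<subseteq> B k l \<and> Q l \<inter> B k l = {}"
    by metis
  then have "(\<Union>k. \<Inter>l. B k l) \<in> sets borel" "(\<Union>k. P k) \<subseteq> (\<Union>k. \<Inter>l. B k l)"
    "(\<Union>l. Q l) \<inter> (\<Union>k. \<Inter>l. B k l) = {}"
    by (auto, blast+)
  then show ?thesis
    unfolding borel_separated_def by blast
qed

lemma image_cylinder_eventually_subset:
  fixes f :: "(nat \<Rightarrow> nat) \<Rightarrow> 'a::topological_space"
  assumes f: "continuous_on UNIV f" and U: "open U" "f b \<in> U"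
    and u: "\<And>n. b \<in> cylinder (u n)" "\<And>n. n \<le> length (u n)"
  obtains N where "\<And>n. n \<ge> N \<Longrightarrow> f ` cylinder (u n) \<subseteq> U"
proof -
  have "open (f -` U)"
    using U(1) f by (rule open_vimage)
  then obtain N where N: "cylinder (map b [0..<N]) \<subseteq> f -` U"
    using U(2) open_contains_cylinder[of "f -` U" b] by auto
  show thesis
  proof
    fix n assume "n \<ge> N"
    then have "cylinder (u n) \<subseteq> cylinder (map b [0..<N])"
      using u(1)[of n] u(2)[of n] by (auto simp: cylinder_def)
    then show "f ` cylinder (u n) \<subseteq> U"
      using N by blast
  qed
qed

text \<open>Inseparability descends along two nested sequences of cylinders, which shrink to codes
  of a point of \<open>E\<close> and a point of \<open>F\<close>. These points differ, and disjoint
  open neighbourhoods of them separate the images of late cylinders, a contradiction.\<close>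

theorem lusin_separation:
  fixes E F :: "'a::t2_space set"
  assumes "borel_image E" and "borel_image F" and disj: "E \<inter> F = {}"
  shows "borel_separated E F"
proof (rule ccontr)
  assume contra: "\<not> borel_separated E F"
  obtain f :: "(nat \<Rightarrow> nat) \<Rightarrow> 'a" and C
    where f: "continuous_on UNIV f" and C: "closed C" and E: "E = f ` C"
    using borel_image_closed[OF assms(1)] by metis
  obtain g :: "(nat \<Rightarrow> nat) \<Rightarrow> 'a" and D
    where g: "continuous_on UNIV g" and D: "closed D" and F: "F = g ` D"
    using borel_image_closed[OF assms(2)] by metis
  let ?P = "\<lambda>w. f ` (C \<inter> cylinder w)" and ?Q = "\<lambda>w. g ` (D \<inter> cylinder w)"
  define bad where
    "bad n w \<longleftrightarrow> n \<le> length (fst w) \<and> n \<le> length (snd w) \<and> \<not> borel_separated (?P (fst w)) (?Q (snd w))"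
    for n :: nat and w :: "nat list \<times> nat list"
  have "bad 0 ([], [])"
    using contra by (simp add: bad_def E F)
  moreover have "\<exists>w'. bad (Suc n) w' \<and>
      cylinder (fst w') \<subseteq> cylinder (fst w) \<and> cylinder (snd w') \<subseteq> cylinder (snd w)"
    if w: "bad n w" for n w
  proof -
    have "?P (fst w) = (\<Union>k. ?P (fst w @ [k]))" "?Q (snd w) = (\<Union>l. ?Q (snd w @ [l]))"
      by (subst cylinder_UN_snoc, blast)+
    then have "\<not> borel_separated (\<Union>k. ?P (fst w @ [k])) (\<Union>l. ?Q (snd w @ [l]))"
      using w unfolding bad_def by simp
    then obtain k l where "\<not> borel_separated (?P (fst w @ [k])) (?Q (snd w @ [l]))"
      using borel_separated_UN[of "\<lambda>k. ?P (fst w @ [k])" "\<lambda>l. ?Q (snd w @ [l])"] by auto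
    then have "bad (Suc n) (fst w @ [k], snd w @ [l])"
      using w by (simp add: bad_def)
    then show ?thesis
      by (intro exI[of _ "(fst w @ [k], snd w @ [l])"]) (auto simp: cylinder_def nth_append less_Suc_eq)
  qed
  ultimately obtain w where w: "\<And>n. bad n (w n)"
    and nest: "\<And>n. cylinder (fst (w (Suc n))) \<subseteq> cylinder (fst (w n)) \<and>
      cylinder (snd (w (Suc n))) \<subseteq> cylinder (snd (w n))"
    using dependent_nat_choice[of bad "\<lambda>n w w'. cylinder (fst w') \<subseteq> cylinder (fst w) \<and>
      cylinder (snd w') \<subseteq> cylinder (snd w)"] by blast
  have len: "n \<le> length (fst (w n))" "n \<le> length (snd (w n))" for n
    using w[of n] by (auto simp: bad_def)
  obtain b where b: "\<And>n. b \<in> cylinder (fst (w n))"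
    and lim_b: "\<And>c. (\<And>n. c n \<in> cylinder (fst (w n))) \<Longrightarrow> c \<longlonglongrightarrow> b"
    using nested_cylinders[of "\<lambda>n. fst (w n)"] nest len by blast
  obtain d where d: "\<And>n. d \<in> cylinder (snd (w n))"
    and lim_d: "\<And>c. (\<And>n. c n \<in> cylinder (snd (w n))) \<Longrightarrow> c \<longlonglongrightarrow> d"
    using nested_cylinders[of "\<lambda>n. snd (w n)"] nest len by blast
  \<comment> \<open>An empty set is separated from everything, so both cylinders still meet the
    closed code sets at every stage; hence the limits \<open>b\<close> and \<open>d\<close> lie in
    \<open>C\<close> and \<open>D\<close>.\<close>
  have "\<exists>c. c \<in> C \<inter> cylinder (fst (w n))" "\<exists>c. c \<in> D \<inter> cylinder (snd (w n))" for n
  proof -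
    have "borel_separated {} Q" "borel_separated P {}" for P Q :: "'a set"
      unfolding borel_separated_def by (auto intro: bexI[of _ "{}"] bexI[of _ UNIV])
    then show "\<exists>c. c \<in> C \<inter> cylinder (fst (w n))" "\<exists>c. c \<in> D \<inter> cylinder (snd (w n))"
      using w[of n] unfolding bad_def by (metis ex_in_conv image_empty)+
  qed
  then obtain c c' where c: "\<And>n. c n \<in> C" "\<And>n. c n \<in> cylinder (fst (w n))"
    and c': "\<And>n. c' n \<in> D" "\<And>n. c' n \<in> cylinder (snd (w n))"
    by (metis Int_iff)
  have "b \<in> C"
    using closed_sequentially[OF C] c(1) lim_b[OF c(2)] by blast
  moreover have "d \<in> D"
    using closed_sequentially[OF D] c'(1) lim_d[OF c'(2)] by blast
  ultimately have "f b \<noteq> g d"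
    using disj unfolding E F by blast
  then obtain U V where UV: "open U" "open V" "f b \<in> U" "g d \<in> V" "U \<inter> V = {}"
    using hausdorff by metis
  obtain M where M: "\<And>n. n \<ge> M \<Longrightarrow> f ` cylinder (fst (w n)) \<subseteq> U"
    using image_cylinder_eventually_subset[OF f UV(1,3), of "\<lambda>n. fst (w n)"] b len by metis
  obtain N where N: "\<And>n. n \<ge> N \<Longrightarrow> g ` cylinder (snd (w n)) \<subseteq> V"
    using image_cylinder_eventually_subset[OF g UV(2,4), of "\<lambda>n. snd (w n)"] d len by metis
  let ?n = "max M N"
  have "borel_separated (?P (fst (w ?n))) (?Q (snd (w ?n)))"
    unfolding borel_separated_def
    using M[of ?n] N[of ?n] UV by (intro bexI[of _ U]) (auto simp: borel_open)
  then show False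
    using w[of ?n] unfolding bad_def by blast
qed

section \<open>Enlarging analytic anticliques to Borel ones\<close>

text \<open>A neighbour is coded by an edge code together with a point code in \<open>B\<close> for
  the first end of the edge. Their compatibility is an equation between continuous maps, hence a
  closed condition.\<close>

lemma borel_image_neighbours:
  fixes g :: "(nat \<Rightarrow> nat) \<Rightarrow> 'a::polish_space \<times> 'a"
  assumes g: "continuous_on UNIV g" and "borel_image E"
  shows "borel_image (range g `` E)"
proof -
  obtain f :: "(nat \<Rightarrow> nat) \<Rightarrow> 'a" and B
    where f: "continuous_on UNIV f" and B: "B \<in> sets borel" and E: "E = f ` B"
    using assms(2) unfolding borel_image_def by blast
  let ?B = "{p. snd p \<in> B \<and> fst (g (fst p)) = f (snd p)}"
  have g1: "continuous_on UNIV (\<lambda>p :: (nat \<Rightarrow> nat) \<times> (nat \<Rightarrow> nat). g (fst p))"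
    by (rule continuous_on_compose2[OF g]) (auto intro: continuous_intros)
  have f2: "continuous_on UNIV (\<lambda>p :: (nat \<Rightarrow> nat) \<times> (nat \<Rightarrow> nat). f (snd p))"
    by (rule continuous_on_compose2[OF f]) (auto intro: continuous_intros)
  have "snd -` B \<in> sets (borel :: ((nat \<Rightarrow> nat) \<times> (nat \<Rightarrow> nat)) measure)"
    using B by (intro measurable_sets_borel[OF borel_measurable_continuous_onI] continuous_intros)
  moreover have "closed {p :: (nat \<Rightarrow> nat) \<times> (nat \<Rightarrow> nat). fst (g (fst p)) = f (snd p)}"
    using g1 f2 by (intro closed_Collect_eq continuous_on_fst)
  ultimately have "snd -` B \<inter> {p. fst (g (fst p)) = f (snd p)} \<in> sets borel"
    by (intro sets.Int[OF _ borel_closed])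
  moreover have "?B = snd -` B \<inter> {p. fst (g (fst p)) = f (snd p)}"
    by auto
  ultimately have "?B \<in> sets borel"
    by simp
  then have "borel_image ((\<lambda>p. snd (g (fst p))) ` ?B)"
    using g1 by (intro borel_image_pair continuous_on_snd)
  moreover have "(\<lambda>p. snd (g (fst p))) ` ?B = range g `` E"
    unfolding E by (force simp: image_iff prod_eq_iff)
  ultimately show ?thesis by simp
qed

lemma borel_image_borel_neighbours:
  fixes g :: "(nat \<Rightarrow> nat) \<Rightarrow> 'a::polish_space \<times> 'a"
  assumes g: "continuous_on UNIV g" and B: "B \<in> sets borel"
  shows "borel_image (range g `` B)"
  unfolding borel_image_def
proof (intro exI conjI)
  show "continuous_on UNIV (\<lambda>b. snd (g b))"
    using g by (rule continuous_on_snd)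
  show "(\<lambda>b. fst (g b)) -` B \<in> sets borel"
    using g B by (intro measurable_sets_borel[OF borel_measurable_continuous_onI] continuous_on_fst)
  show "range g `` B = (\<lambda>b. snd (g b)) ` ((\<lambda>b. fst (g b)) -` B)"
    by (force simp: image_iff prod_eq_iff)
qed

text \<open>First separate \<open>E\<close> from its neighbours by a Borel set \<open>B\<close>,
  then separate \<open>E\<close> from the neighbours of \<open>B\<close> by \<open>B'\<close>. No
  point of \<open>B'\<close> is adjacent to a point of \<open>B\<close>, so their intersection is an
  anticlique.\<close>

lemma borel_anticlique_extension:
  fixes G :: "('a::polish_space \<times> 'a) set"
  assumes "analytic_set G" and sym: "sym G" and E: "borel_image E" and anti: "anticlique G E"
  obtains H where "H \<in> sets borel" "E \<subseteq> H" "anticlique G H"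
proof (cases "G = {}")
  case True
  then show thesis
    by (intro that[of UNIV]) (auto simp: anticlique_def)
next
  case False
  then obtain g :: "(nat \<Rightarrow> nat) \<Rightarrow> 'a \<times> 'a" where g: "continuous_on UNIV g" "range g = G"
    using assms(1) unfolding analytic_set_def by blast
  have "E \<inter> G `` E = {}"
    using anti unfolding anticlique_def by blast
  then obtain B where B: "B \<in> sets borel" "E \<subseteq> B" "G `` E \<inter> B = {}"
    using lusin_separation[OF E borel_image_neighbours[OF g(1) E]]
    unfolding g(2) borel_separated_def by blast
  \<comment> \<open>By symmetry, a point of \<open>E\<close> adjacent to some point of
    \<open>B\<close> would make that point of \<open>B\<close> a neighbour of
    \<open>E\<close>.\<close>
  have "E \<inter> G `` B = {}"
    using B(3) sym by (auto dest: symD)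
  then obtain B' where B': "B' \<in> sets borel" "E \<subseteq> B'" "G `` B \<inter> B' = {}"
    using lusin_separation[OF E borel_image_borel_neighbours[OF g(1) B(1)]]
    unfolding g(2) borel_separated_def by blast
  show thesis
  proof
    show "B \<inter> B' \<in> sets borel"
      using B(1) B'(1) by simp
    show "E \<subseteq> B \<inter> B'"
      using B(2) B'(2) by simp
    show "anticlique G (B \<inter> B')"
      using B'(3) unfolding anticlique_def by blast
  qed
qed

subsection \<open>The Silver graph and Baire category\<close>

text \<open>Membership in \<open>B\<close> is locally constant on \<open>K\<close>; equivalently,
  the trace of \<open>B\<close> on \<open>K\<close> is relatively clopen.\<close>

definition decided_on :: "'a::topological_space set \<Rightarrow> 'a set \<Rightarrow> bool" where
  "decided_on K B \<longleftrightarrow> (\<forall>x\<in>K. \<exists>U. open U \<and> x \<in> U \<and> (\<forall>y\<in>U \<inter> K. y \<in> B \<longleftrightarrow> x \<in> B))"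

lemma decided_on_mono:
  assumes "decided_on K B" and "L \<subseteq> K"
  shows "decided_on L B"
  unfolding decided_on_def
proof
  fix x assume "x \<in> L"
  then obtain U where "open U" "x \<in> U" "\<forall>y\<in>U \<inter> K. y \<in> B \<longleftrightarrow> x \<in> B"
    using assms unfolding decided_on_def by (meson subsetD)
  then show "\<exists>U. open U \<and> x \<in> U \<and> (\<forall>y\<in>U \<inter> L. y \<in> B \<longleftrightarrow> x \<in> B)"
    using assms(2) by (intro exI[of _ U]) auto
qed

lemma open_Un_interior_Compl_dense:
  assumes "open U"
  shows "open (U \<union> - closure U)" and "closure (U \<union> - closure U) = UNIV"
proof -
  show "open (U \<union> - closure U)"
    using assms by auto
  have "closure U \<union> - closure U \<subseteq> closure (U \<union> - closure U)"
    using closure_subset[of "- closure U"] by (auto simp: closure_Un)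
  then show "closure (U \<union> - closure U) = UNIV"
    by auto
qed

text \<open>A substitute for the Baire property of Borel sets.\<close>

lemma borel_decided:
  assumes "B \<in> sets borel"
  obtains \<D> where "countable \<D>" "\<And>D. D \<in> \<D> \<Longrightarrow> open D \<and> closure D = UNIV"
    "decided_on (\<Inter>\<D>) B"
proof -
  let ?Q = "\<lambda>\<D> B. countable \<D> \<and> (\<forall>D\<in>\<D>. open D \<and> closure D = UNIV) \<and> decided_on (\<Inter>\<D>) B"
  have "B \<in> sigma_sets UNIV {S. open S}"
    using assms by (simp add: sets_borel)
  then have "\<exists>\<D>. ?Q \<D> B"
  proof induction
    case (Basic U)
    then have "open U" by simp
    have "decided_on (U \<union> - closure U) U"
      unfolding decided_on_def
    proof
      fix x assume "x \<in> U \<union> - closure U"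
      then show "\<exists>V. open V \<and> x \<in> V \<and> (\<forall>y\<in>V \<inter> (U \<union> - closure U). (y \<in> U) = (x \<in> U))"
      proof
        assume "x \<in> U"
        then show ?thesis
          using \<open>open U\<close> by (intro exI[of _ U]) auto
      next
        assume "x \<in> - closure U"
        then show ?thesis
          using closure_subset[of U] by (intro exI[of _ "- closure U"]) auto
      qed
    qed
    then show ?case
      using open_Un_interior_Compl_dense[OF \<open>open U\<close>] by (intro exI[of _ "{U \<union> - closure U}"]) simp
  next
    case Empty
    show ?case
      by (intro exI[of _ "{}"]) (auto simp: decided_on_def)
  next
    case (Compl B)
    then show ?case
      by (simp add: decided_on_def)
  next
    case (Union B)
    then obtain \<D> where \<D>: "\<And>n. ?Q (\<D> n) (B n)"
      by metis
    define K where "K = (\<Inter>n. \<Inter>(\<D> n))"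
    have dec: "decided_on K (B n)" for n
      using \<D>[of n] by (auto intro: decided_on_mono simp: K_def)
    \<comment> \<open>On \<open>K\<close> each \<open>B n\<close> is relatively open, hence so is
      the union; \<open>W\<close> is the largest open set with trace on \<open>K\<close> inside the
      union. Removing the boundary of \<open>W\<close> by one more dense open set makes this trace
      clopen.\<close>
    define W where "W = \<Union>{U. open U \<and> U \<inter> K \<subseteq> (\<Union>n. B n)}"
    have W: "open W"
      unfolding W_def by auto
    have W_sub: "W \<inter> K \<subseteq> (\<Union>n. B n)"
      unfolding W_def by blast
    have sub_W: "(\<Union>n. B n) \<inter> K \<subseteq> W"
    proof
      fix x assume x: "x \<in> (\<Union>n. B n) \<inter> K"
      then obtain n where n: "x \<in> B n" by blast
      have "x \<in> K" using x by simp
      then obtain U where "open U" "x \<in> U" "\<forall>y\<in>U \<inter> K. y \<in> B n"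
        using dec[of n] n unfolding decided_on_def by meson
      then show "x \<in> W"
        unfolding W_def by blast
    qed
    let ?W = "W \<union> - closure W"
    let ?\<D> = "insert ?W (\<Union>n. \<D> n)"
    have Inter: "\<Inter>?\<D> = ?W \<inter> K"
      by (auto simp: K_def)
    have "decided_on (?W \<inter> K) (\<Union>n. B n)"
      unfolding decided_on_def
    proof
      fix x assume x: "x \<in> ?W \<inter> K"
      show "\<exists>V. open V \<and> x \<in> V \<and> (\<forall>y\<in>V \<inter> (?W \<inter> K). (y \<in> (\<Union>n. B n)) = (x \<in> (\<Union>n. B n)))"
      proof (cases "x \<in> W")
        case True
        then show ?thesis
          using W W_sub x by (intro exI[of _ W]) blast
      next
        case False
        then show ?thesis
          using sub_W x closure_subset[of W] by (intro exI[of _ "- closure W"]) blast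
      qed
    qed
    moreover have "countable ?\<D>"
      using \<D> by auto
    moreover have "\<forall>D\<in>?\<D>. open D \<and> closure D = UNIV"
      using \<D> open_Un_interior_Compl_dense[OF W] by blast
    ultimately show ?case
      unfolding Inter[symmetric] by blast
  qed
  then show thesis
    using that by blast
qed

section \<open>Generic points of the Cantor space and their flips\<close>

definition flip :: "nat \<Rightarrow> (nat \<Rightarrow> bool) \<Rightarrow> nat \<Rightarrow> bool" where
  "flip n x = x(n := \<not> x n)"

lemma flip_flip [simp]: "flip n (flip n x) = x"
  by (auto simp: flip_def)

lemma silver_graph_flip: "(x, flip n x) \<in> silver_graph"
  by (auto simp: silver_graph_def flip_def intro!: ex1I[of _ n])

lemma continuous_flip: "continuous_on S (flip n)"
proof (rule continuous_on_coordinatewise_then_product)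
  fix i
  have coord: "continuous_on S (\<lambda>x :: nat \<Rightarrow> bool. x i)"
    by (rule continuous_on_subset[OF continuous_on_product_coordinates]) simp
  have "continuous_on UNIV Not"
    by (simp add: continuous_on_open_vimage open_discrete)
  then have "continuous_on S (\<lambda>x :: nat \<Rightarrow> bool. \<not> x i)"
    by (rule continuous_on_compose2[OF _ coord]) simp
  then show "continuous_on S (\<lambda>x. flip n x i)"
    using coord by (cases "i = n") (simp_all add: flip_def)
qed

lemma flip_tendsto: "(\<lambda>n. flip n x) \<longlonglongrightarrow> x"
proof (rule tendsto_fun_componentwise)
  show "(\<lambda>n. flip n x i) \<longlonglongrightarrow> x i" for i
    by (intro tendsto_eventually eventually_sequentiallyI[of "Suc i"]) (simp add: flip_def)
qed

text \<open>A flip is a continuous involution, so its preimages are also its images, and continuous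
  images of dense sets under a surjection are dense.\<close>

lemma open_dense_flip:
  assumes "open D" and "closure D = UNIV"
  shows "open (flip n -` D)" and "closure (flip n -` D) = UNIV"
proof -
  show "open (flip n -` D)"
    using assms(1) continuous_flip by (rule open_vimage)
  have vim: "flip n ` D = flip n -` D"
  proof (intro equalityI subsetI)
    fix x assume "x \<in> flip n -` D"
    then show "x \<in> flip n ` D"
      by (intro image_eqI[of x "flip n" "flip n x"]) simp_all
  qed auto
  have "flip n ` closure D \<subseteq> closure (flip n ` D)"
    by (intro image_closure_subset continuous_flip closure_subset) simp
  then have "flip n (flip n x) \<in> closure (flip n -` D)" for x
    unfolding assms(2) vim by blast
  then show "closure (flip n -` D) = UNIV"
    by auto
qed

text \<open>The Cantor space is compact Hausdorff, so the Baire category theorem applies.\<close>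

lemma dense_Inter_nonempty:
  fixes \<D> :: "(nat \<Rightarrow> bool) set set"
  assumes "countable \<D>" and "\<And>D. D \<in> \<D> \<Longrightarrow> open D \<and> closure D = UNIV"
  shows "\<Inter>\<D> \<noteq> {}"
proof -
  let ?X = "euclidean :: (nat \<Rightarrow> bool) topology"
  have prod: "?X = product_topology (\<lambda>_. euclidean) UNIV"
    by (simp add: euclidean_product_topology)
  have "compact (UNIV :: bool set)"
    by (intro finite_imp_compact) simp
  then have "compact_space (euclidean :: bool topology)"
    by (simp add: compact_space_def)
  then have "compact_space ?X"
    unfolding prod by (simp add: compact_space_product_topology)
  moreover have "Hausdorff_space (euclidean :: bool topology)"
    unfolding Hausdorff_space_def disjnt_def
    using hausdorff[where 'a = bool] by (simp flip: open_openin)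
  then have "Hausdorff_space ?X"
    unfolding prod by (simp add: Hausdorff_space_product_topology)
  ultimately have "locally_compact_space ?X \<and> regular_space ?X"
    using compact_imp_locally_compact_space compact_Hausdorff_imp_regular_space by blast
  moreover have "openin ?X D \<and> ?X closure_of D = topspace ?X" if "D \<in> \<D>" for D
    using assms(2)[OF that] by simp
  ultimately have "?X closure_of \<Inter>\<D> = topspace ?X"
    using assms(1) by (intro Baire_category) auto
  then show ?thesis
    by auto
qed

text \<open>At a generic \<open>x\<close> in \<open>B n\<close>, all generic points close to
  \<open>x\<close> lie in \<open>B n\<close>. The flips of \<open>x\<close> are generic too and
  converge to \<open>x\<close>, so one of them lies in \<open>B n\<close>.\<close>

lemma silver_graph_borel_cover:
  assumes "\<And>n :: nat. B n \<in> sets borel" and "(\<Union>n. B n) = UNIV"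
  obtains n x y where "x \<in> B n" "y \<in> B n" "(x, y) \<in> silver_graph"
proof -
  have "\<forall>n. \<exists>\<D>. countable \<D> \<and> (\<forall>D\<in>\<D>. open D \<and> closure D = UNIV) \<and> decided_on (\<Inter>\<D>) (B n)"
    using borel_decided[OF assms(1)] by metis
  then obtain \<D> where \<D>: "\<And>n. countable (\<D> n)"
      "\<And>n D. D \<in> \<D> n \<Longrightarrow> open D \<and> closure D = UNIV" "\<And>n. decided_on (\<Inter>(\<D> n)) (B n)"
    by metis
  \<comment> \<open>Adding the preimages under all flips makes every flip of a point of the
    intersection generic as well.\<close>
  define K where "K = (\<Union>n. \<D> n) \<union> (\<Union>k. (\<lambda>D. flip k -` D) ` (\<Union>n. \<D> n))"
  have "\<Inter>K \<noteq> {}"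
  proof (rule dense_Inter_nonempty)
    show "countable K"
      using \<D>(1) by (simp add: K_def)
    show "open D \<and> closure D = UNIV" if "D \<in> K" for D
      using that \<D>(2) open_dense_flip unfolding K_def by (elim UnE UN_E imageE) auto
  qed
  then obtain x where x: "x \<in> \<Inter>K" by blast
  then have xD: "x \<in> \<Inter>(\<D> n)" for n
    unfolding K_def by blast
  have fD: "flip k x \<in> \<Inter>(\<D> n)" for n k
  proof
    fix D assume "D \<in> \<D> n"
    then have "flip k -` D \<in> K"
      unfolding K_def by blast
    then show "flip k x \<in> D"
      using x by blast
  qed
  obtain n where n: "x \<in> B n"
    using assms(2) by blast
  then obtain U where U: "open U" "x \<in> U" "\<forall>y\<in>U \<inter> \<Inter>(\<D> n). y \<in> B n"
    using \<D>(3)[of n] xD[of n] unfolding decided_on_def by meson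
  have "eventually (\<lambda>k. flip k x \<in> U) sequentially"
    using flip_tendsto U(1,2) by (rule topological_tendstoD)
  then obtain k where "flip k x \<in> U"
    using eventually_happens[of _ sequentially] by auto
  then have "flip k x \<in> B n"
    using U(3) fD by blast
  then show thesis
    using that n silver_graph_flip by blast
qed

text \<open>Borel anticliques covering \<open>A\<close> would pull back to a countable Borel cover
  of the Cantor space. One piece then contains a Silver edge, which \<open>h\<close> sends to an
  edge inside an anticlique.\<close>

lemma silver_homomorphism_not_anticlique_ideal:
  fixes h :: "(nat \<Rightarrow> bool) \<Rightarrow> 'a::topological_space"
  assumes h: "continuous_on UNIV h" "range h \<subseteq> A" "graph_homomorphism silver_graph G h"
  shows "A \<notin> anticlique_ideal G"
proof
  assume "A \<in> anticlique_ideal G"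
  then obtain F where F: "countable F" "F \<subseteq> {C. C \<in> sets borel \<and> anticlique G C}" "A \<subseteq> \<Union>F"
    unfolding anticlique_ideal_def mem_sigma_ideal_hull_iff by blast
  have "F \<noteq> {}"
    using F(3) h(2) by auto
  define C where "C = from_nat_into F"
  have C: "range C = F"
    unfolding C_def using \<open>F \<noteq> {}\<close> F(1) by (rule range_from_nat_into)
  have C_F: "C n \<in> sets borel" "anticlique G (C n)" for n
    using F(2) rangeI[of C n] unfolding C by auto
  have borel: "h -` C n \<in> sets borel" for n
    using C_F(1) by (rule measurable_sets_borel[OF borel_measurable_continuous_onI[OF h(1)]])
  have "x \<in> (\<Union>n. h -` C n)" for x
  proof -
    have "h x \<in> \<Union>(range C)"
      using F(3) h(2) unfolding C by (meson rangeI subsetD)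
    then show ?thesis by simp
  qed
  then have "(\<Union>n. h -` C n) = UNIV"
    by (intro equalityI subsetI UNIV_I)
  with borel show False
  proof (rule silver_graph_borel_cover)
    fix n x y assume "x \<in> h -` C n" "y \<in> h -` C n" "(x, y) \<in> silver_graph"
    then show False
      using h(3) C_F(2)[of n] unfolding anticlique_def graph_homomorphism_def by auto
  qed
qed

subsection \<open>Projections of Borel sets\<close>

text \<open>The projected set is Borel rather than closed so that the class is stable under
  preimages by Borel maps, such as those of the action.\<close>

definition borel_projection :: "'a::{second_countable_topology, t2_space} set \<Rightarrow> bool" where
  "borel_projection E \<longleftrightarrow> (\<exists>C :: ('a \<times> (nat \<Rightarrow> nat)) set. C \<in> sets borel \<and> E = fst ` C)"

lemma borel_projectionI:
  fixes C :: "('a::{second_countable_topology, t2_space} \<times> (nat \<Rightarrow> nat)) set"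
  assumes "C \<in> sets borel" and "E = fst ` C"
  shows "borel_projection E"
  using assms unfolding borel_projection_def by auto

lemma mem_fst_image_iff: "x \<in> fst ` C \<longleftrightarrow> (\<exists>b. (x, b) \<in> C)"
  by force

lemma borel_projection_vimage:
  fixes \<phi> :: "'a::{second_countable_topology, t2_space} \<Rightarrow> 'b::{second_countable_topology, t2_space}"
  assumes \<phi>: "\<phi> \<in> borel_measurable borel" and "borel_projection E"
  shows "borel_projection (\<phi> -` E)"
proof -
  obtain C :: "('b \<times> (nat \<Rightarrow> nat)) set" where C: "C \<in> sets borel" "E = fst ` C"
    using assms(2) unfolding borel_projection_def by auto
  have "(\<lambda>p :: 'a \<times> (nat \<Rightarrow> nat). \<phi> (fst p)) \<in> borel_measurable borel"
    by (intro measurable_compose[OF borel_measurable_continuous_onI \<phi>] continuous_intros)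
  moreover have "(\<lambda>p :: 'a \<times> (nat \<Rightarrow> nat). snd p) \<in> borel_measurable borel"
    by (intro borel_measurable_continuous_onI continuous_intros)
  ultimately have "(\<lambda>p :: 'a \<times> (nat \<Rightarrow> nat). (\<phi> (fst p), snd p)) \<in> borel_measurable borel"
    by (rule borel_measurable_Pair)
  then have "(\<lambda>p. (\<phi> (fst p), snd p)) -` C \<in> sets borel"
    using C(1) by (rule measurable_sets_borel)
  moreover have "\<phi> -` E = fst ` ((\<lambda>p. (\<phi> (fst p), snd p)) -` C)"
    unfolding C(2) by (auto simp: mem_fst_image_iff)
  ultimately show ?thesis
    by (rule borel_projectionI)
qed

lemma borel_projection_Int:
  assumes "borel_projection E" and "borel_projection F"
  shows "borel_projection (E \<inter> F)"
proof -
  obtain C :: "('a \<times> (nat \<Rightarrow> nat)) set" where C: "C \<in> sets borel" "E = fst ` C"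
    using assms(1) unfolding borel_projection_def by auto
  obtain D :: "('a \<times> (nat \<Rightarrow> nat)) set" where D: "D \<in> sets borel" "F = fst ` D"
    using assms(2) unfolding borel_projection_def by auto
  let ?c = "\<lambda>p :: 'a \<times> (nat \<Rightarrow> nat). (fst p, fst (unpair (snd p)))"
  let ?d = "\<lambda>p :: 'a \<times> (nat \<Rightarrow> nat). (fst p, snd (unpair (snd p)))"
  have un: "continuous_on UNIV (\<lambda>p :: 'a \<times> (nat \<Rightarrow> nat). unpair (snd p))"
    by (rule continuous_on_compose2[OF continuous_unpair[of UNIV]]) (auto intro: continuous_intros)
  have "continuous_on UNIV ?c" "continuous_on UNIV ?d"
    by (intro continuous_on_Pair continuous_on_fst[OF un] continuous_on_snd[OF un]
        continuous_on_fst[OF continuous_on_id])+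
  then have "?c -` C \<in> sets borel" "?d -` D \<in> sets borel"
    by (blast intro: measurable_sets_borel[OF borel_measurable_continuous_onI] C(1) D(1))+
  then have "?c -` C \<inter> ?d -` D \<in> sets borel"
    by (rule sets.Int)
  moreover have "E \<inter> F = fst ` (?c -` C \<inter> ?d -` D)"
  proof (intro equalityI subsetI)
    fix x assume "x \<in> E \<inter> F"
    then obtain b d where "(x, b) \<in> C" "(x, d) \<in> D"
      unfolding C(2) D(2) by auto
    moreover obtain e where "unpair e = (b, d)"
      using surj_unpair by (metis surjD)
    ultimately have "(x, e) \<in> ?c -` C \<inter> ?d -` D"
      by simp
    then show "x \<in> fst ` (?c -` C \<inter> ?d -` D)"
      by (rule image_eqI[rotated]) simp
  next
    fix x assume "x \<in> fst ` (?c -` C \<inter> ?d -` D)"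
    then show "x \<in> E \<inter> F"
      unfolding C(2) D(2) by force
  qed
  ultimately show ?thesis
    by (rule borel_projectionI)
qed

lemma borel_projection_borel:
  fixes B :: "'a::{second_countable_topology, t2_space} set"
  assumes "B \<in> sets borel"
  shows "borel_projection B"
proof (rule borel_projectionI)
  show "fst -` B \<in> sets (borel :: ('a \<times> (nat \<Rightarrow> nat)) measure)"
    using assms by (intro measurable_sets_borel[OF borel_measurable_continuous_onI] continuous_intros)
  show "B = fst ` (fst -` B :: ('a \<times> (nat \<Rightarrow> nat)) set)"
    by (simp add: surj_image_vimage_eq)
qed

lemma borel_projection_image_cylinder:
  fixes f :: "(nat \<Rightarrow> nat) \<Rightarrow> 'a::{second_countable_topology, t2_space}"
  assumes "continuous_on UNIV f"
  shows "borel_projection (f ` cylinder u)"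
proof (rule borel_projectionI)
  let ?C = "{p. fst p = f (snd p)} \<inter> snd -` cylinder u"
  have "continuous_on UNIV (\<lambda>p :: 'a \<times> (nat \<Rightarrow> nat). f (snd p))"
    by (rule continuous_on_compose2[OF assms]) (auto intro: continuous_intros)
  then have "closed ?C"
    by (intro closed_Int closed_Collect_eq closed_vimage closed_cylinder continuous_intros)
  then show "?C \<in> sets borel"
    by (rule borel_closed)
  show "f ` cylinder u = fst ` ?C"
    by (rule Set.set_eqI, simp only: mem_fst_image_iff) auto
qed

text \<open>Each point of \<open>E\<close> has an \<open>f\<close>-code, so it can be replaced by a
  code and \<open>E\<close> becomes an image from the square of the Baire space. This makes the
  separation results applicable to projections.\<close>

lemma borel_projection_imp_borel_image:
  fixes f :: "(nat \<Rightarrow> nat) \<Rightarrow> 'a::{second_countable_topology, t2_space}"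
  assumes f: "continuous_on UNIV f" and "borel_projection E" and "E \<subseteq> range f"
  shows "borel_image E"
proof -
  obtain C :: "('a \<times> (nat \<Rightarrow> nat)) set" where C: "C \<in> sets borel" "E = fst ` C"
    using assms(2) unfolding borel_projection_def by auto
  have f1: "continuous_on UNIV (\<lambda>p :: (nat \<Rightarrow> nat) \<times> (nat \<Rightarrow> nat). f (fst p))"
    by (rule continuous_on_compose2[OF f]) (auto intro: continuous_intros)
  then have "(\<lambda>p. (f (fst p), snd p)) -` C \<in> sets borel"
    using C(1) by (intro measurable_sets_borel[OF borel_measurable_continuous_onI] continuous_intros)
  with f1 have "borel_image ((\<lambda>p. f (fst p)) ` ((\<lambda>p. (f (fst p), snd p)) -` C))"
    by (rule borel_image_pair)
  moreover have "(\<lambda>p. f (fst p)) ` ((\<lambda>p. (f (fst p), snd p)) -` C) = E"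
  proof (intro equalityI subsetI)
    fix x assume "x \<in> E"
    then obtain b d where "(f b, d) \<in> C" "x = f b"
      using assms(3) unfolding C(2) by force
    then show "x \<in> (\<lambda>p. f (fst p)) ` ((\<lambda>p. (f (fst p), snd p)) -` C)"
      by (intro image_eqI[of _ _ "(b, d)"]) auto
  qed (force simp: C(2))
  ultimately show ?thesis by simp
qed

subsection \<open>Positive sets\<close>

lemma anticlique_ideal_subset:
  assumes "A \<in> anticlique_ideal G" and "B \<subseteq> A"
  shows "B \<in> anticlique_ideal G"
  using assms unfolding anticlique_ideal_def mem_sigma_ideal_hull_iff by (meson subset_trans)

text \<open>Subtracting a Borel cover, instead of a set in the ideal itself, keeps the remainder of
  a Borel projection a Borel projection.\<close>

lemma anticlique_ideal_borel_cover:
  assumes "A \<in> anticlique_ideal G"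
  obtains B where "B \<in> sets borel" "A \<subseteq> B" "B \<in> anticlique_ideal G"
proof -
  obtain F where F: "countable F" "F \<subseteq> {C. C \<in> sets borel \<and> anticlique G C}" "A \<subseteq> \<Union>F"
    using assms unfolding anticlique_ideal_def mem_sigma_ideal_hull_iff by blast
  show thesis
  proof
    show "\<Union>F \<in> sets borel"
      using F(1,2) by (intro sets.countable_Union) auto
    show "\<Union>F \<in> anticlique_ideal G"
      unfolding anticlique_ideal_def mem_sigma_ideal_hull_iff using F(1,2) by blast
  qed (fact F(3))
qed

lemma anticlique_ideal_UN:
  fixes B :: "'i \<Rightarrow> 'a::topological_space set"
  assumes "countable J" and "\<And>j. j \<in> J \<Longrightarrow> B j \<in> anticlique_ideal G"
  shows "(\<Union>j\<in>J. B j) \<in> anticlique_ideal G"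
proof -
  have "\<forall>j\<in>J. \<exists>F. countable F \<and> F \<subseteq> {C. C \<in> sets borel \<and> anticlique G C} \<and> B j \<subseteq> \<Union>F"
    using assms(2) unfolding anticlique_ideal_def mem_sigma_ideal_hull_iff by blast
  then obtain F where F: "\<forall>j\<in>J. countable (F j) \<and> F j \<subseteq> {C. C \<in> sets borel \<and> anticlique G C} \<and> B j \<subseteq> \<Union>(F j)"
    by (rule bchoice[THEN exE])
  show ?thesis
    unfolding anticlique_ideal_def mem_sigma_ideal_hull_iff
  proof (intro exI conjI)
    show "countable (\<Union>j\<in>J. F j)"
      using assms(1) F by (intro countable_UN) auto
    show "(\<Union>j\<in>J. F j) \<subseteq> {C. C \<in> sets borel \<and> anticlique G C}"
      using F by (intro UN_least) simp
    show "(\<Union>j\<in>J. B j) \<subseteq> \<Union>(\<Union>j\<in>J. F j)"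
    proof (rule UN_least)
      fix j assume "j \<in> J"
      then have "B j \<subseteq> \<Union>(F j)" "F j \<subseteq> (\<Union>j\<in>J. F j)"
        using F by auto
      then show "B j \<subseteq> \<Union>(\<Union>j\<in>J. F j)"
        by (meson Union_mono subset_trans)
    qed
  qed
qed

lemma borel_anticlique_in_ideal:
  assumes "B \<in> sets borel" and "anticlique G B"
  shows "B \<in> anticlique_ideal G"
  unfolding anticlique_ideal_def mem_sigma_ideal_hull_iff
  using assms by (intro exI[of _ "{B}"]) simp

text \<open>In the application \<open>T\<close> consists of the maps \<open>x \<mapsto> \<gamma> \<cdot> x\<close>, and \<open>f\<close> parametrises \<open>A\<close>.\<close>

locale borel_covered_graph =
  fixes G :: "('a::polish_space \<times> 'a) set" and T :: "('a \<Rightarrow> 'a) set"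
    and f :: "(nat \<Rightarrow> nat) \<Rightarrow> 'a" and g :: "(nat \<Rightarrow> nat) \<Rightarrow> 'a \<times> 'a"
  assumes sym: "sym G" and irrefl: "irrefl G"
    and f: "continuous_on UNIV f" and g: "continuous_on UNIV g" and range_g: "range g = G"
    and countable_T: "countable T"
    and measurable_T: "\<And>\<tau>. \<tau> \<in> T \<Longrightarrow> \<tau> \<in> borel_measurable borel"
    and invariant_T: "\<And>\<tau> x y. \<tau> \<in> T \<Longrightarrow> (x, y) \<in> G \<Longrightarrow> (\<tau> x, \<tau> y) \<in> G"
    and covered: "\<And>x y. (x, y) \<in> G \<Longrightarrow> \<exists>\<tau>\<in>T. y = \<tau> x"
begin

text \<open>The sets through which the fusion runs. Containment in \<open>range f\<close> supplies
  every point with a code.\<close>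

definition positive :: "'a set \<Rightarrow> bool" where
  "positive E \<longleftrightarrow> borel_projection E \<and> E \<subseteq> range f \<and> E \<notin> anticlique_ideal G"

lemma positive_nonempty:
  assumes "positive E"
  shows "E \<noteq> {}"
  using assms borel_anticlique_in_ideal[of "{}" G] unfolding positive_def anticlique_def by auto

lemma borel_projection_edges:
  assumes "\<phi> \<in> borel_measurable borel" and "\<psi> \<in> borel_measurable borel"
  shows "borel_projection {x. (\<phi> x, \<psi> x) \<in> g ` cylinder u}"
  using borel_projection_vimage[OF borel_measurable_Pair[OF assms] borel_projection_image_cylinder[OF g]]
  by (simp add: vimage_def)

text \<open>If all these sets were in the ideal, a Borel set \<open>B\<close> in the ideal would
  cover their countable union. Every edge inside \<open>E\<close> is realised by some
  \<open>\<tau>\<close>, so \<open>E\<close> minus \<open>B\<close> is an anticlique; a Borel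
  anticlique \<open>H\<close> contains it, and \<open>B\<close> with \<open>H\<close> covers
  \<open>E\<close>.\<close>

lemma positive_edge:
  assumes "positive E"
  obtains \<tau> where "\<tau> \<in> T" "positive {x \<in> E. \<tau> x \<in> E \<and> (x, \<tau> x) \<in> G}"
proof -
  let ?R = "\<lambda>\<tau>. {x \<in> E. \<tau> x \<in> E \<and> (x, \<tau> x) \<in> G}"
  have E: "borel_projection E" "E \<subseteq> range f" "E \<notin> anticlique_ideal G"
    using assms unfolding positive_def by auto
  have "\<exists>\<tau>\<in>T. ?R \<tau> \<notin> anticlique_ideal G"
  proof (rule ccontr)
    assume contra: "\<not> (\<exists>\<tau>\<in>T. ?R \<tau> \<notin> anticlique_ideal G)"
    then have "(\<Union>\<tau>\<in>T. ?R \<tau>) \<in> anticlique_ideal G"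
      using countable_T by (intro anticlique_ideal_UN) auto
    then obtain B where B: "B \<in> sets borel" "(\<Union>\<tau>\<in>T. ?R \<tau>) \<subseteq> B" "B \<in> anticlique_ideal G"
      by (rule anticlique_ideal_borel_cover)
    have anti: "anticlique G (E \<inter> - B)"
      unfolding anticlique_def
    proof (intro ballI notI)
      fix x y assume xy: "x \<in> E \<inter> - B" "y \<in> E \<inter> - B" "(x, y) \<in> G"
      then obtain \<tau> where "\<tau> \<in> T" "y = \<tau> x"
        using covered by blast
      then have "x \<in> (\<Union>\<tau>\<in>T. ?R \<tau>)"
        using xy by auto
      then show False
        using B(2) xy(1) by blast
    qed
    have "borel_projection (E \<inter> - B)"
      using B(1) by (intro borel_projection_Int E(1) borel_projection_borel) (simp add: borel_comp)
    then have "borel_image (E \<inter> - B)"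
      using E(2) by (intro borel_projection_imp_borel_image[OF f]) auto
    moreover have "analytic_set G"
      using g range_g unfolding analytic_set_def by blast
    ultimately obtain H where H: "H \<in> sets borel" "E \<inter> - B \<subseteq> H" "anticlique G H"
      using borel_anticlique_extension[OF _ sym _ anti] by blast
    have "(\<Union>b\<in>UNIV. if b then B else H) \<in> anticlique_ideal G"
      using B(3) borel_anticlique_in_ideal[OF H(1,3)] by (intro anticlique_ideal_UN) auto
    moreover have "E \<subseteq> (\<Union>b\<in>UNIV. if b then B else H)"
      using H(2) by (auto simp: UNIV_bool)
    ultimately show False
      using E(3) anticlique_ideal_subset by blast
  qed
  then obtain \<tau> where \<tau>: "\<tau> \<in> T" "?R \<tau> \<notin> anticlique_ideal G"
    by blast
  \<comment> \<open>The image of \<open>cylinder []\<close> under \<open>g\<close> is all of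
    \<open>G\<close>, so the edge condition is a Borel projection.\<close>
  have "?R \<tau> = E \<inter> (\<tau> -` E \<inter> {x. (x, \<tau> x) \<in> g ` cylinder []})"
    using range_g by auto
  moreover have "borel_projection (E \<inter> (\<tau> -` E \<inter> {x. (x, \<tau> x) \<in> g ` cylinder []}))"
    using \<tau>(1) E(1) measurable_T
    by (intro borel_projection_Int borel_projection_vimage borel_projection_edges) auto
  ultimately have "positive (?R \<tau>)"
    using \<tau>(2) E(2) unfolding positive_def by auto
  with \<tau>(1) show thesis
    by (rule that)
qed

text \<open>This makes finitely many pointwise witnesses uniform. For one index, countably many
  values of \<open>w\<close> split the set into pieces, one of which is outside the ideal; the
  indices are treated in turn, and shrinking preserves what was already arranged.\<close>

lemma positive_refine:
  fixes Q :: "'i \<Rightarrow> 'a \<Rightarrow> 'w::countable \<Rightarrow> bool"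
  assumes "finite P" and "positive E"
    and "\<And>i x. i \<in> P \<Longrightarrow> x \<in> E \<Longrightarrow> \<exists>w. Q i x w"
    and "\<And>i w. i \<in> P \<Longrightarrow> borel_projection {x. Q i x w}"
  obtains D c where "D \<subseteq> E" "positive D" "\<And>i x. i \<in> P \<Longrightarrow> x \<in> D \<Longrightarrow> Q i x (c i)"
proof -
  have "\<exists>D c. D \<subseteq> E \<and> positive D \<and> (\<forall>i\<in>P. \<forall>x\<in>D. Q i x (c i))"
    using assms(1,3,4)
  proof (induction P)
    case empty
    then show ?case
      using assms(2) by blast
  next
    case (insert j P)
    then obtain D c where D: "D \<subseteq> E" "positive D" "\<forall>i\<in>P. \<forall>x\<in>D. Q i x (c i)"
      by (metis insertCI)
    have "D \<subseteq> (\<Union>w. D \<inter> {x. Q j x w})"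
      using insert.prems(1)[of j] D(1) by auto
    moreover have "D \<notin> anticlique_ideal G"
      using D(2) by (simp add: positive_def)
    ultimately have "(\<Union>w\<in>UNIV. D \<inter> {x. Q j x w}) \<notin> anticlique_ideal G"
      using anticlique_ideal_subset by blast
    then obtain w where w: "D \<inter> {x. Q j x w} \<notin> anticlique_ideal G"
      using anticlique_ideal_UN[of "UNIV :: 'w set" "\<lambda>w. D \<inter> {x. Q j x w}" G] by auto
    have "positive (D \<inter> {x. Q j x w})"
      using w D(2) insert.prems(2)[of j w] unfolding positive_def
      by (auto intro: borel_projection_Int)
    moreover have "\<forall>i\<in>insert j P. \<forall>x\<in>D \<inter> {x. Q j x w}. Q i x ((c(j := w)) i)"
      using D(3) insert.hyps(2) by auto
    ultimately show ?case
      using D(1) by (intro exI[of _ "D \<inter> {x. Q j x w}"] exI[of _ "c(j := w)"]) auto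
  qed
  then show thesis
    using that by blast
qed

end

subsection \<open>Fusion\<close>

text \<open>Finite binary strings are stored in reverse, so that extending a string is \<open>Cons\<close>.\<close>

primrec restriction :: "(nat \<Rightarrow> bool) \<Rightarrow> nat \<Rightarrow> bool list" where
  "restriction x 0 = []"
| "restriction x (Suc n) = x n # restriction x n"

fun silver_adjacent :: "bool list \<Rightarrow> bool list \<Rightarrow> bool" where
  "silver_adjacent (i # s) (j # t) \<longleftrightarrow> (i = j \<and> silver_adjacent s t) \<or> (i \<noteq> j \<and> s = t)"
| "silver_adjacent _ _ \<longleftrightarrow> False"

lemma length_restriction [simp]: "length (restriction x n) = n"
  by (induction n) auto

lemma silver_adjacent_length: "silver_adjacent s t \<Longrightarrow> length s = length t"
  by (induction s t rule: silver_adjacent.induct) auto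

lemma silver_adjacent_irrefl: "\<not> silver_adjacent s s"
  by (induction s) auto

lemma restriction_neq:
  assumes "x \<noteq> y"
  obtains n where "restriction x n \<noteq> restriction y n"
proof -
  obtain n where "x n \<noteq> y n"
    using assms by auto
  then show thesis
    by (intro that[of "Suc n"]) simp
qed

lemma silver_adjacent_restriction:
  assumes "(x, y) \<in> silver_graph"
  shows "\<exists>m. \<forall>n>m. silver_adjacent (restriction x n) (restriction y n)"
proof -
  from assms have "\<exists>!m. x m \<noteq> y m"
    by (simp add: silver_graph_def)
  then obtain m where m: "x m \<noteq> y m" "\<And>k. k \<noteq> m \<Longrightarrow> x k = y k"
    by metis
  have "restriction x n = restriction y n" if "n \<le> m" for n
    using that by (induction n) (simp_all add: m(2))
  \<comment> \<open>\<open>Suc m\<close> is the first length that includes entry \<open>m\<close>: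
    there the heads differ and the tails are equal. Each later entry adds equal heads.\<close>
  then have "silver_adjacent (restriction x (Suc m + k)) (restriction y (Suc m + k))" for k
    by (induction k) (auto simp: m)
  then have "silver_adjacent (restriction x n) (restriction y n)" if "n > m" for n
    using that by (metis Suc_leI le_add_diff_inverse)
  then show ?thesis
    by blast
qed

lemma open_restriction: "open {x. P (restriction x n)}"
proof (induction n arbitrary: P)
  case (Suc n)
  have "open ((\<lambda>x :: nat \<Rightarrow> bool. x n) -` {b})" for b
    by (intro open_vimage continuous_on_product_coordinates) (simp add: open_discrete)
  then have "open ((\<lambda>x. x n) -` {True} \<inter> {x. P (True # restriction x n)} \<union>
      (\<lambda>x. x n) -` {False} \<inter> {x. P (False # restriction x n)})"
    using Suc.IH by (intro open_Un open_Int) auto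
  moreover have "(\<lambda>x. x n) -` {True} \<inter> {x. P (True # restriction x n)} \<union>
      (\<lambda>x. x n) -` {False} \<inter> {x. P (False # restriction x n)} = {x. P (restriction x (Suc n))}"
  proof (rule Set.set_eqI)
    fix x
    show "x \<in> (\<lambda>x. x n) -` {True} \<inter> {x. P (True # restriction x n)} \<union>
      (\<lambda>x. x n) -` {False} \<inter> {x. P (False # restriction x n)} \<longleftrightarrow> x \<in> {x. P (restriction x (Suc n))}"
      by (cases "x n") simp_all
  qed
  ultimately show ?case
    by simp
qed simp

section \<open>The stages of the construction and the limit map\<close>

context borel_covered_graph
begin

text \<open>
  Here \<open>\<phi> s\<close> is the action of \<open>\<gamma>\<^sub>s\<close>, \<open>U s\<close> is an initial segment of an \<open>f\<close>-code of \<open>\<gamma>\<^sub>s a\<close>, and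
  \<open>V s t\<close> is an initial segment of a \<open>g\<close>-code of \<open>(\<gamma>\<^sub>s a, \<gamma>\<^sub>t a)\<close>, the same for all \<open>a \<in> E\<close>.
\<close>

definition stage :: "nat \<Rightarrow> 'a set \<Rightarrow> (bool list \<Rightarrow> 'a \<Rightarrow> 'a) \<Rightarrow> (bool list \<Rightarrow> nat list) \<Rightarrow>
    (bool list \<Rightarrow> bool list \<Rightarrow> nat list) \<Rightarrow> bool" where
  "stage n E \<phi> U V \<longleftrightarrow> positive E \<and>
     (\<forall>s. length s = n \<longrightarrow>
        \<phi> s \<in> borel_measurable borel \<and> (\<forall>x y. (x, y) \<in> G \<longrightarrow> (\<phi> s x, \<phi> s y) \<in> G) \<and>
        n \<le> length (U s) \<and> (\<forall>x\<in>E. \<phi> s x \<in> f ` cylinder (U s))) \<and>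
     (\<forall>s t. length s = n \<longrightarrow> length t = n \<longrightarrow> s \<noteq> t \<longrightarrow> f ` cylinder (U s) \<inter> f ` cylinder (U t) = {}) \<and>
     (\<forall>s t. length s = n \<longrightarrow> silver_adjacent s t \<longrightarrow>
        n \<le> length (V s t) \<and> (\<forall>x\<in>E. (\<phi> s x, \<phi> t x) \<in> g ` cylinder (V s t)))"

lemma stage_Nil:
  assumes "positive (range f)"
  shows "stage 0 (range f) (\<lambda>_ x. x) (\<lambda>_. []) (\<lambda>_ _. [])"
  using assms by (auto simp: stage_def)

lemma image_cylinder_prefix:
  fixes f' :: "(nat \<Rightarrow> nat) \<Rightarrow> 'b"
  assumes "y \<in> f' ` cylinder u"
  obtains w where "n \<le> length w" "cylinder w \<subseteq> cylinder u" "y \<in> f' ` cylinder w"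
proof -
  obtain b where b: "b \<in> cylinder u" "y = f' b"
    using assms by auto
  show thesis
  proof
    show "n \<le> length (map b [0..<max n (length u)])"
      by simp
    show "cylinder (map b [0..<max n (length u)]) \<subseteq> cylinder u"
      using b(1) by (rule cylinder_prefix_subset) simp
    show "y \<in> f' ` cylinder (map b [0..<max n (length u)])"
      using b(2) mem_cylinder_prefix by blast
  qed
qed

text \<open>Disjoint neighbourhoods of \<open>x\<close> and \<open>y\<close> pull back to initial
  segments of their codes; the common length is large enough for separation, containment in
  \<open>cylinder u\<close> and the bound \<open>n\<close> at once.\<close>

lemma image_cylinder_separate:
  assumes "x \<in> f ` cylinder u" "y \<in> f ` cylinder u" "x \<noteq> y"
  obtains w w' where "n \<le> length w" "n \<le> length w'" "cylinder w \<subseteq> cylinder u" "cylinder w' \<subseteq> cylinder u"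
    "x \<in> f ` cylinder w" "y \<in> f ` cylinder w'" "f ` cylinder w \<inter> f ` cylinder w' = {}"
proof -
  obtain b c where b: "b \<in> cylinder u" "x = f b" and c: "c \<in> cylinder u" "y = f c"
    using assms(1,2) by auto
  obtain X Y where XY: "open X" "open Y" "x \<in> X" "y \<in> Y" "X \<inter> Y = {}"
    using hausdorff[OF assms(3)] by blast
  have "open (f -` X)" "open (f -` Y)"
    using XY(1,2) f by (auto intro: open_vimage)
  then obtain k l where k: "cylinder (map b [0..<k]) \<subseteq> f -` X" and l: "cylinder (map c [0..<l]) \<subseteq> f -` Y"
    using XY(3,4) unfolding b(2) c(2) by (metis open_contains_cylinder vimageI)
  let ?m = "max (max k l) (max n (length u))"
  have sub: "cylinder (map b [0..<?m]) \<subseteq> cylinder (map b [0..<k])"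
    "cylinder (map c [0..<?m]) \<subseteq> cylinder (map c [0..<l])"
    by (rule cylinder_prefix_subset[OF mem_cylinder_prefix]; simp)+
  have "f ` cylinder (map b [0..<?m]) \<subseteq> X" "f ` cylinder (map c [0..<?m]) \<subseteq> Y"
    using order_trans[OF sub(1) k] order_trans[OF sub(2) l] by (simp_all add: image_subset_iff_subset_vimage)
  then have "f ` cylinder (map b [0..<?m]) \<inter> f ` cylinder (map c [0..<?m]) \<subseteq> X \<inter> Y"
    by (rule Int_mono)
  then have disj: "f ` cylinder (map b [0..<?m]) \<inter> f ` cylinder (map c [0..<?m]) = {}"
    unfolding XY(5) by (rule subset_empty[THEN iffD1])
  show thesis
  proof
    show "cylinder (map b [0..<?m]) \<subseteq> cylinder u" "cylinder (map c [0..<?m]) \<subseteq> cylinder u"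
      by (rule cylinder_prefix_subset[OF b(1)] cylinder_prefix_subset[OF c(1)]; simp)+
    show "x \<in> f ` cylinder (map b [0..<?m])" "y \<in> f ` cylinder (map c [0..<?m])"
      by (simp_all add: b(2) c(2) mem_cylinder_prefix)
    show "f ` cylinder (map b [0..<?m]) \<inter> f ` cylinder (map c [0..<?m]) = {}"
      by (rule disj)
  qed simp_all
qed

text \<open>After \<open>positive_edge\<close> supplies \<open>\<tau>\<close>, the positive set is
  shrunk twice: first to fix longer \<open>f\<close>-codes separating the two extensions of each
  string, then to fix longer \<open>g\<close>-codes for all adjacent pairs.\<close>

lemma stage_Suc:
  assumes "stage n E \<phi> U V"
  obtains E' \<phi>' U' V' where "stage (Suc n) E' \<phi>' U' V'"
    and "\<And>i s. length s = n \<Longrightarrow> cylinder (U' (i # s)) \<subseteq> cylinder (U s)"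
    and "\<And>i s t. length s = n \<Longrightarrow> silver_adjacent s t \<Longrightarrow> cylinder (V' (i # s) (i # t)) \<subseteq> cylinder (V s t)"
proof -
  note st = assms[unfolded stage_def]
  note st_map = st[THEN conjunct2, THEN conjunct1, rule_format]
  have E: "positive E"
    using st by (rule conjunct1)
  have \<phi>: "\<phi> s \<in> borel_measurable borel" "\<And>x y. (x, y) \<in> G \<Longrightarrow> (\<phi> s x, \<phi> s y) \<in> G"
    and U: "\<And>x. x \<in> E \<Longrightarrow> \<phi> s x \<in> f ` cylinder (U s)" if "length s = n" for s
    using st_map[OF that] by simp_all
  note disj = st[THEN conjunct2, THEN conjunct2, THEN conjunct1, rule_format]
  have V: "(\<phi> s x, \<phi> t x) \<in> g ` cylinder (V s t)"
    if "length s = n" "silver_adjacent s t" "x \<in> E" for s t x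
    using st[THEN conjunct2, THEN conjunct2, THEN conjunct2, rule_format, OF that(1,2)] that(3) by simp
  obtain \<tau> where \<tau>: "\<tau> \<in> T" and pos1: "positive {x \<in> E. \<tau> x \<in> E \<and> (x, \<tau> x) \<in> G}"
    using E by (rule positive_edge)
  define E1 where "E1 = {x \<in> E. \<tau> x \<in> E \<and> (x, \<tau> x) \<in> G}"
  \<comment> \<open>The new bit acts first and the old map last. On \<open>E1\<close> both choices
    of the bit stay in \<open>E\<close>, so the old code cylinders remain valid for the new
    points.\<close>
  define \<phi>' where "\<phi>' r x = \<phi> (tl r) (if hd r then \<tau> x else x)" for r x
  have \<phi>'_meas: "\<phi>' r \<in> borel_measurable borel" if "length r = Suc n" for r
  proof -
    have "\<phi> (tl r) \<in> borel_measurable borel"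
      using that by (intro \<phi>) simp
    then show ?thesis
      using measurable_compose[OF measurable_T[OF \<tau>]] unfolding \<phi>'_def by (cases "hd r") simp_all
  qed
  have \<phi>'_G: "(\<phi>' r x, \<phi>' r y) \<in> G" if "length r = Suc n" "(x, y) \<in> G" for r x y
    unfolding \<phi>'_def using that invariant_T[OF \<tau>] by (intro \<phi>(2)) auto
  have move: "(if i then \<tau> x else x) \<in> E" if "x \<in> E1" for i x
    using that by (simp add: E1_def)

  \<comment> \<open>A witness for \<open>s\<close> is a pair of strings, one for each extension of
    \<open>s\<close>, because the two images must be disjoint; \<open>sel\<close> picks one by the
    new bit.\<close>
  define sel :: "bool \<Rightarrow> nat list \<times> nat list \<Rightarrow> nat list"
    where "sel i w = (if i then snd w else fst w)" for i w
  define P where "P s x w \<longleftrightarrow>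
      (\<forall>i. Suc n \<le> length (sel i w) \<and>
        cylinder (sel i w) \<subseteq> cylinder (U s) \<and>
        \<phi>' (i # s) x \<in> f ` cylinder (sel i w)) \<and>
      f ` cylinder (sel False w) \<inter> f ` cylinder (sel True w) = {}"
    for s x and w :: "nat list \<times> nat list"
  obtain E2 c where E2: "E2 \<subseteq> E1" "positive E2"
    and c: "\<And>s x. length s = n \<Longrightarrow> x \<in> E2 \<Longrightarrow> P s x (c s)"
  proof (rule positive_refine[of "{s :: bool list. length s = n}" E1 P])
    show "finite {s :: bool list. length s = n}"
      using finite_lists_length_eq[of "UNIV :: bool set" n] by simp
    show "positive E1"
      using pos1 by (simp add: E1_def)
    show "\<exists>w. P s x w" if "s \<in> {s. length s = n}" "x \<in> E1" for s x
    proof -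
      have s: "length s = n" using that(1) by simp
      \<comment> \<open>By invariance the two new points form an edge, so irreflexivity makes them
        distinct and hence separable.\<close>
      have "(\<phi> s x, \<phi> s (\<tau> x)) \<in> G"
        using that(2) s by (intro \<phi>(2)) (auto simp: E1_def)
      then have "\<phi> s x \<noteq> \<phi> s (\<tau> x)"
        using irrefl unfolding irrefl_def by metis
      moreover have "\<phi> s x \<in> f ` cylinder (U s)" "\<phi> s (\<tau> x) \<in> f ` cylinder (U s)"
        using that(2) s by (auto simp: E1_def intro!: U)
      ultimately obtain w w' where "Suc n \<le> length w" "Suc n \<le> length w'"
        "cylinder w \<subseteq> cylinder (U s)" "cylinder w' \<subseteq> cylinder (U s)"
        "\<phi> s x \<in> f ` cylinder w" "\<phi> s (\<tau> x) \<in> f ` cylinder w'" "f ` cylinder w \<inter> f ` cylinder w' = {}"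
        using image_cylinder_separate by metis
      then have "P s x (w, w')"
        unfolding P_def \<phi>'_def sel_def by simp
      then show ?thesis by blast
    qed
    \<comment> \<open>The clauses of \<open>P\<close> that do not involve \<open>x\<close> leave
      either the empty set or an intersection of two preimages.\<close>
    show "borel_projection {x. P s x w}" if "s \<in> {s. length s = n}" for s w
    proof (cases "(\<forall>i. Suc n \<le> length (sel i w) \<and>
        cylinder (sel i w) \<subseteq> cylinder (U s)) \<and>
        f ` cylinder (sel False w) \<inter> f ` cylinder (sel True w) = {}")
      case True
      then have "{x. P s x w} =
          \<phi>' (True # s) -` (f ` cylinder (sel True w)) \<inter> \<phi>' (False # s) -` (f ` cylinder (sel False w))"
        unfolding P_def by (auto simp: all_bool_eq)
      then show ?thesis
        using that by (simp only:) (intro borel_projection_Int borel_projection_vimage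
            borel_projection_image_cylinder f \<phi>'_meas; simp)
    next
      case False
      then have "{x. P s x w} = {}"
        unfolding P_def by blast
      then show ?thesis
        by (simp add: borel_projection_borel)
    qed
  qed auto
  define U' where "U' r = sel (hd r) (c (tl r))" for r
  \<comment> \<open>\<open>c s\<close> is the same for all points of \<open>E2\<close>, so the
    clauses not mentioning the point can be read off at a single one.\<close>
  obtain x0 where x0: "x0 \<in> E2"
    using positive_nonempty[OF E2(2)] by blast
  have U': "Suc n \<le> length (U' (i # s))" "cylinder (U' (i # s)) \<subseteq> cylinder (U s)"
    "x \<in> E2 \<Longrightarrow> \<phi>' (i # s) x \<in> f ` cylinder (U' (i # s))"
    if "length s = n" for i s x
    using c[OF that x0] c[OF that, of x] unfolding P_def U'_def by simp_all
  have U'_disj: "f ` cylinder (U' (i # s)) \<inter> f ` cylinder (U' (j # s)) = {}"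
    if "length s = n" "i \<noteq> j" for i j s
    using c[OF that(1) x0] that(2) unfolding P_def U'_def by (cases i; cases j) auto

  \<comment> \<open>With equal heads the pair continues an older adjacent pair and its code must
    extend the old one. With different heads the edge is new and its code starts afresh.\<close>
  define Q where "Q p x w \<longleftrightarrow> Suc n \<le> length w \<and>
      (hd (fst p) = hd (snd p) \<longrightarrow> cylinder w \<subseteq> cylinder (V (tl (fst p)) (tl (snd p)))) \<and>
      (\<phi>' (fst p) x, \<phi>' (snd p) x) \<in> g ` cylinder w"
    for p :: "bool list \<times> bool list" and x and w :: "nat list"
  let ?I = "{p. length (fst p) = Suc n \<and> silver_adjacent (fst p) (snd p)}"
  obtain E3 v where E3: "E3 \<subseteq> E2" "positive E3"
    and v: "\<And>p x. p \<in> ?I \<Longrightarrow> x \<in> E3 \<Longrightarrow> Q p x (v p)"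
  proof (rule positive_refine[of ?I E2 Q])
    have "?I \<subseteq> {r :: bool list. length r = Suc n} \<times> {r. length r = Suc n}"
      using silver_adjacent_length by fastforce
    moreover have "finite {r :: bool list. length r = Suc n}"
      using finite_lists_length_eq[of "UNIV :: bool set" "Suc n"] by simp
    ultimately show "finite ?I"
      by (meson finite_SigmaI finite_subset)
    show "\<exists>w. Q p x w" if p: "p \<in> ?I" and x: "x \<in> E2" for p x
    proof -
      have "silver_adjacent (fst p) (snd p)" "length (fst p) = Suc n"
        using p by auto
      then obtain i s j t where ij: "fst p = i # s" "snd p = j # t" "length s = n"
        and adj: "(i = j \<and> silver_adjacent s t) \<or> (i \<noteq> j \<and> s = t)"
        by (cases "fst p"; cases "snd p") auto
      have "x \<in> E1"
        using x E2(1) by blast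
      show ?thesis
      proof (cases "i = j")
        case True
        then have "(\<phi>' (i # s) x, \<phi>' (j # t) x) \<in> g ` cylinder (V s t)"
          using adj V[OF ij(3) _ move[OF \<open>x \<in> E1\<close>, of i]] unfolding \<phi>'_def by simp
        then obtain w where "Suc n \<le> length w" "cylinder w \<subseteq> cylinder (V s t)"
            "(\<phi>' (i # s) x, \<phi>' (j # t) x) \<in> g ` cylinder w"
          by (rule image_cylinder_prefix)
        then show ?thesis
          unfolding Q_def ij by auto
      next
        case False
        then have "s = t"
          using adj by simp
        have "(x, \<tau> x) \<in> G"
          using \<open>x \<in> E1\<close> by (simp add: E1_def)
        \<comment> \<open>Either order of the two bits may occur, so the edge is needed in both
          directions.\<close>
        then have "(\<phi> s x, \<phi> s (\<tau> x)) \<in> G" "(\<phi> s (\<tau> x), \<phi> s x) \<in> G"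
          using \<phi>(2)[OF ij(3)] sym by (auto dest: symD)
        then have "(\<phi>' (i # s) x, \<phi>' (j # t) x) \<in> g ` cylinder []"
          using False \<open>s = t\<close> range_g unfolding \<phi>'_def by (cases i) auto
        then obtain w where "Suc n \<le> length w" "(\<phi>' (i # s) x, \<phi>' (j # t) x) \<in> g ` cylinder w"
          by (rule image_cylinder_prefix)
        then show ?thesis
          using False unfolding Q_def ij by auto
      qed
    qed
    show "borel_projection {x. Q p x w}" if p: "p \<in> ?I" for p w
    proof (cases "Suc n \<le> length w \<and>
        (hd (fst p) = hd (snd p) \<longrightarrow> cylinder w \<subseteq> cylinder (V (tl (fst p)) (tl (snd p))))")
      case True
      then have "{x. Q p x w} = {x. (\<phi>' (fst p) x, \<phi>' (snd p) x) \<in> g ` cylinder w}"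
        unfolding Q_def by simp
      moreover have "length (snd p) = Suc n"
        using p silver_adjacent_length by fastforce
      ultimately show ?thesis
        using p borel_projection_edges[OF \<phi>'_meas \<phi>'_meas] by simp
    next
      case False
      then have "{x. Q p x w} = {}"
        unfolding Q_def by blast
      then show ?thesis
        by (simp add: borel_projection_borel)
    qed
  qed (use E2(2) in auto)
  define V' where "V' s t = v (s, t)" for s t
  obtain x1 where x1: "x1 \<in> E3"
    using positive_nonempty[OF E3(2)] by blast
  have V': "Suc n \<le> length (V' r r')"
    "x \<in> E3 \<Longrightarrow> (\<phi>' r x, \<phi>' r' x) \<in> g ` cylinder (V' r r')"
    if "length r = Suc n" "silver_adjacent r r'" for r r' x
    using v[of "(r, r')" x1] v[of "(r, r')" x] x1 that unfolding Q_def V'_def by simp_all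
  show thesis
  proof
    show "stage (Suc n) E3 \<phi>' U' V'"
      unfolding stage_def
    proof (intro conjI allI impI ballI)
      fix r :: "bool list" assume r: "length r = Suc n"
      then obtain i s where rs: "r = i # s" "length s = n"
        by (cases r) auto
      show "\<phi>' r \<in> borel_measurable borel"
        using r by (rule \<phi>'_meas)
      show "(\<phi>' r x, \<phi>' r y) \<in> G" if "(x, y) \<in> G" for x y
        using r that by (rule \<phi>'_G)
      show "Suc n \<le> length (U' r)"
        unfolding rs(1) using rs(2) by (rule U')
      show "\<phi>' r x \<in> f ` cylinder (U' r)" if "x \<in> E3" for x
        unfolding rs(1) using rs(2) that E3(1) by (intro U') auto
      show "f ` cylinder (U' r) \<inter> f ` cylinder (U' r') = {}"
        if r': "length r' = Suc n" and neq: "r \<noteq> r'" for r'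
      proof -
        obtain j t where jt: "r' = j # t" "length t = n"
          using r' by (cases r') auto
        show ?thesis
        proof (cases "s = t")
          case True
          then show ?thesis
            using neq U'_disj[of s i j] rs jt by simp
        next
          case False
          \<comment> \<open>Distinct tails were separated at the previous stage, and the new
            cylinders lie inside the old ones.\<close>
          then show ?thesis
            using disj[OF rs(2) jt(2)] U'(2)[OF rs(2), of i] U'(2)[OF jt(2), of j]
            unfolding rs(1) jt(1) by blast
        qed
      qed
      show "Suc n \<le> length (V' r r')" if "silver_adjacent r r'" for r'
        using r that by (rule V')
      show "(\<phi>' r x, \<phi>' r' x) \<in> g ` cylinder (V' r r')" if "silver_adjacent r r'" "x \<in> E3" for r' x
        using r that by (rule V')
    qed (fact E3(2))
    show "cylinder (U' (i # s)) \<subseteq> cylinder (U s)" if "length s = n" for i s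
      using that by (rule U')
    show "cylinder (V' (i # s) (i # t)) \<subseteq> cylinder (V s t)" if "length s = n" "silver_adjacent s t" for i s t
      using v[of "(i # s, i # t)" x1] x1 that unfolding Q_def V'_def by simp
  qed
qed

text \<open>Along each \<open>x\<close> the point codes converge to \<open>\<beta> x\<close>, and
  the map is \<open>f\<close> composed with \<open>\<beta>\<close>. Injectivity comes from disjoint
  images at a stage where the restrictions differ, and edges are preserved because the edge codes
  converge too.\<close>

theorem positive_imp_silver_homomorphism:
  assumes "range f \<notin> anticlique_ideal G"
  obtains h :: "(nat \<Rightarrow> bool) \<Rightarrow> 'a" where "continuous_on UNIV h" "inj h" "range h \<subseteq> range f"
    "graph_homomorphism silver_graph G h"
proof -
  have "borel_projection (range f)"
    using borel_projection_image_cylinder[OF f, of "[]"] by simp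
  then have pos: "positive (range f)"
    using assms by (simp add: positive_def)
  \<comment> \<open>The data of a stage form one tuple, to which dependent choice is
    applied.\<close>
  define good where "good n S \<longleftrightarrow> (case S of (E, \<phi>, U, V) \<Rightarrow> stage n E \<phi> U V)" for n S
  define extends where "extends n S S' \<longleftrightarrow> (case (S, S') of ((E, \<phi>, U, V), (E', \<phi>', U', V')) \<Rightarrow>
      (\<forall>i s. length s = n \<longrightarrow> cylinder (U' (i # s)) \<subseteq> cylinder (U s)) \<and>
      (\<forall>i s t. length s = n \<longrightarrow> silver_adjacent s t \<longrightarrow> cylinder (V' (i # s) (i # t)) \<subseteq> cylinder (V s t)))"
    for n and S S' :: "'a set \<times> (bool list \<Rightarrow> 'a \<Rightarrow> 'a) \<times> (bool list \<Rightarrow> nat list) \<times>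
      (bool list \<Rightarrow> bool list \<Rightarrow> nat list)"
  have "good 0 (range f, \<lambda>_ x. x, \<lambda>_. [], \<lambda>_ _. [])"
    using stage_Nil[OF pos] by (simp add: good_def)
  moreover have "\<exists>S'. good (Suc n) S' \<and> extends n S S'" if "good n S" for n S
  proof -
    obtain E \<phi> U V where S: "S = (E, \<phi>, U, V)"
      by (cases S)
    then have "stage n E \<phi> U V"
      using that by (simp add: good_def)
    then show ?thesis
    proof (rule stage_Suc)
      fix E' \<phi>' U' V'
      assume "stage (Suc n) E' \<phi>' U' V'"
        and "\<And>i s. length s = n \<Longrightarrow> cylinder (U' (i # s)) \<subseteq> cylinder (U s)"
        and "\<And>i s t. length s = n \<Longrightarrow> silver_adjacent s t \<Longrightarrow> cylinder (V' (i # s) (i # t)) \<subseteq> cylinder (V s t)"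
      then show ?thesis
        unfolding S by (intro exI[of _ "(E', \<phi>', U', V')"]) (simp add: good_def extends_def)
    qed
  qed
  ultimately obtain S where S: "\<And>n. good n (S n)" "\<And>n. extends n (S n) (S (Suc n))"
    using dependent_nat_choice[of good extends] by blast
  define E where "E n = fst (S n)" for n
  define \<phi> where "\<phi> n = fst (snd (S n))" for n
  define U where "U n = fst (snd (snd (S n)))" for n
  define V where "V n = snd (snd (snd (S n)))" for n
  have st: "stage n (E n) (\<phi> n) (U n) (V n)" for n
    using S(1)[of n] unfolding good_def E_def \<phi>_def U_def V_def by (simp add: case_prod_beta)
  have nest_U: "cylinder (U (Suc n) (i # s)) \<subseteq> cylinder (U n s)" if "length s = n" for n i s
    using S(2)[of n] that unfolding extends_def U_def by (simp add: case_prod_beta)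
  have nest_V: "cylinder (V (Suc n) (i # s) (i # t)) \<subseteq> cylinder (V n s t)"
    if "length s = n" "silver_adjacent s t" for n i s t
    using S(2)[of n] that unfolding extends_def V_def by (simp add: case_prod_beta)
  note st_map = st[unfolded stage_def, THEN conjunct2, THEN conjunct1, rule_format]
  note st_disj = st[unfolded stage_def, THEN conjunct2, THEN conjunct2, THEN conjunct1, rule_format]
  note st_edge = st[unfolded stage_def, THEN conjunct2, THEN conjunct2, THEN conjunct2, rule_format]
  have "\<exists>b. (\<forall>n. b \<in> cylinder (U n (restriction x n))) \<and>
      (\<forall>c. (\<forall>n. c n \<in> cylinder (U n (restriction x n))) \<longrightarrow> c \<longlonglongrightarrow> b)" for x
  proof -
    have "n \<le> length (U n (restriction x n))" for n
      using st_map[of "restriction x n" n] by simp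
    moreover have "cylinder (U (Suc n) (restriction x (Suc n))) \<subseteq> cylinder (U n (restriction x n))" for n
      using nest_U[of "restriction x n" n] by simp
    ultimately show ?thesis
      using nested_cylinders[of "\<lambda>n. U n (restriction x n)"] by metis
  qed
  then obtain \<beta> where \<beta>: "\<And>x n. \<beta> x \<in> cylinder (U n (restriction x n))"
    and \<beta>_lim: "\<And>x c. (\<And>n. c n \<in> cylinder (U n (restriction x n))) \<Longrightarrow> c \<longlonglongrightarrow> \<beta> x"
    by metis
  \<comment> \<open>Any selection will do: the \<open>a n\<close> need not converge, but their
    translates along the restrictions of \<open>x\<close> have codes in the nested
    cylinders.\<close>
  have "\<exists>a. \<forall>n. a n \<in> E n"
    using positive_nonempty[OF st[unfolded stage_def, THEN conjunct1]] by (intro choice) blast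
  then obtain a where a: "\<And>n. a n \<in> E n"
    by blast
  have "\<exists>b. \<forall>n. b n \<in> cylinder (U n (restriction x n)) \<and> f (b n) = \<phi> n (restriction x n) (a n)" for x
  proof -
    have "\<phi> n (restriction x n) (a n) \<in> f ` cylinder (U n (restriction x n))" for n
      using st_map[of "restriction x n" n] a by simp
    then have "\<forall>n. \<exists>b. b \<in> cylinder (U n (restriction x n)) \<and> f b = \<phi> n (restriction x n) (a n)"
      by (metis imageE)
    then show ?thesis
      by (rule choice)
  qed
  then obtain b where b: "\<And>x n. b x n \<in> cylinder (U n (restriction x n))"
    "\<And>x n. f (b x n) = \<phi> n (restriction x n) (a n)"
    by metis
  have lim: "(\<lambda>n. \<phi> n (restriction x n) (a n)) \<longlonglongrightarrow> f (\<beta> x)" for x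
    using continuous_on_tendsto_compose[OF f \<beta>_lim[of "b x" x]] b by simp
  show thesis
  proof
    show "continuous_on UNIV (\<lambda>x. f (\<beta> x))"
    proof (rule continuous_on_compose2[OF f])
      show "continuous_on UNIV \<beta>"
      proof (rule continuous_on_coordinatewise_then_product)
        fix i
        let ?u = "\<lambda>s. U (Suc i) s ! i"
        \<comment> \<open>Stage \<open>Suc i\<close> fixes at least \<open>i + 1\<close> entries of
          the code, so entry \<open>i\<close> depends only on finitely many coordinates of
          \<open>x\<close>.\<close>
        have "\<beta> x i = ?u (restriction x (Suc i))" for x
          using \<beta>[of x "Suc i"] st_map[of "restriction x (Suc i)" "Suc i"]
          by (simp add: cylinder_def del: restriction.simps)
        moreover have "continuous_on UNIV (\<lambda>x. ?u (restriction x (Suc i)))"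
          unfolding continuous_on_open_vimage[OF open_UNIV]
          using open_restriction[of "\<lambda>s. ?u s \<in> B" "Suc i" for B] by (simp add: vimage_def)
        ultimately show "continuous_on UNIV (\<lambda>x. \<beta> x i)"
          by presburger
      qed
    qed simp
    show "inj (\<lambda>x. f (\<beta> x))"
    proof (rule injI, rule ccontr)
      fix x y assume eq: "f (\<beta> x) = f (\<beta> y)" and "x \<noteq> y"
      then obtain n where "restriction x n \<noteq> restriction y n"
        using restriction_neq by blast
      then have "f ` cylinder (U n (restriction x n)) \<inter> f ` cylinder (U n (restriction y n)) = {}"
        by (intro st_disj) simp_all
      moreover have "f (\<beta> x) \<in> f ` cylinder (U n (restriction x n))"
        "f (\<beta> y) \<in> f ` cylinder (U n (restriction y n))"
        by (intro imageI \<beta>)+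
      ultimately show False
        using eq by auto
    qed
    show "range (\<lambda>x. f (\<beta> x)) \<subseteq> range f"
      by auto
    show "graph_homomorphism silver_graph G (\<lambda>x. f (\<beta> x))"
      unfolding graph_homomorphism_def
    proof (intro allI impI)
      fix x y :: "nat \<Rightarrow> bool" assume xy: "(x, y) \<in> silver_graph"
      then obtain m where m: "\<And>n. n > m \<Longrightarrow> silver_adjacent (restriction x n) (restriction y n)"
        using silver_adjacent_restriction by blast
      \<comment> \<open>If the new heads differed, adjacency at length \<open>Suc n\<close> would
        force equal tails, but these are adjacent at length \<open>n\<close>.\<close>
      have agree: "x n = y n" if "n > m" for n
        using m[OF that] m[of "Suc n"] that silver_adjacent_irrefl by auto
      \<comment> \<open>From length \<open>Suc m\<close> on the restrictions are adjacent, so that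
        \<open>V\<close> provides edge codes, which are nested since later heads agree.\<close>
      let ?k = "\<lambda>n. n + Suc m"
      let ?v = "\<lambda>n. V (?k n) (restriction x (?k n)) (restriction y (?k n))"
      have adj: "silver_adjacent (restriction x (?k n)) (restriction y (?k n))" for n
        by (rule m) simp
      have "n \<le> length (?v n)" for n
        using st_edge[OF _ adj[of n]] by simp
      moreover have "cylinder (?v (Suc n)) \<subseteq> cylinder (?v n)" for n
        using nest_V[where n = "?k n" and i = "y (?k n)", OF _ adj[of n]] agree[of "?k n"] by simp
      ultimately obtain d where d: "\<And>c. (\<And>n. c n \<in> cylinder (?v n)) \<Longrightarrow> c \<longlonglongrightarrow> d"
        using nested_cylinders[of ?v] by metis
      let ?e = "\<lambda>n. (\<phi> (?k n) (restriction x (?k n)) (a (?k n)), \<phi> (?k n) (restriction y (?k n)) (a (?k n)))"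
      have "?e n \<in> g ` cylinder (?v n)" for n
        using st_edge[OF _ adj[of n]] a[of "?k n"] by simp
      then have "\<forall>n. \<exists>c. c \<in> cylinder (?v n) \<and> g c = ?e n"
        by (metis (no_types, lifting) imageE)
      then obtain c where c: "\<And>n. c n \<in> cylinder (?v n)" "\<And>n. g (c n) = ?e n"
        by metis
      \<comment> \<open>The same edges converge to \<open>g d\<close> by edge codes and to the pair
        of limit points by point codes. As \<open>G\<close> need not be closed, the limit is an edge
        only because it is a value of \<open>g\<close>.\<close>
      have "?e \<longlonglongrightarrow> g d"
        using continuous_on_tendsto_compose[OF g d[OF c(1)]] c(2) by simp
      moreover have "?e \<longlonglongrightarrow> (f (\<beta> x), f (\<beta> y))"
        by (intro tendsto_Pair LIMSEQ_ignore_initial_segment[OF lim])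
      ultimately have "g d = (f (\<beta> x), f (\<beta> y))"
        by (rule LIMSEQ_unique)
      then show "(f (\<beta> x), f (\<beta> y)) \<in> G"
        unfolding range_g[symmetric] by (metis rangeI)
    qed
  qed
qed

end

section \<open>Specialisation to the group action\<close>

lemma measurable_action:
  assumes "borel_group_action \<Gamma> act" and "\<gamma> \<in> carrier \<Gamma>"
  shows "act \<gamma> \<in> borel_measurable borel"
proof -
  have "(\<lambda>(\<gamma>, x). act \<gamma> x) \<in> count_space (carrier \<Gamma>) \<Otimes>\<^sub>M borel \<rightarrow>\<^sub>M borel"
    using assms(1) by (simp add: borel_group_action_def)
  then have "(\<lambda>x. case (\<gamma>, x) of (\<gamma>, x) \<Rightarrow> act \<gamma> x) \<in> borel_measurable borel"
    using assms(2) by (intro measurable_compose[OF measurable_Pair1']) auto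
  then show ?thesis
    by simp
qed

theorem theorem4p3:
  fixes \<Gamma> :: "('g, 'm) monoid_scheme"
    and act :: "'g \<Rightarrow> 'a \<Rightarrow> 'a::polish_space"
    and G :: "('a \<times> 'a) set"
    and A :: "'a set"
  assumes "group \<Gamma>"
    and "countable (carrier \<Gamma>)"
    and "borel_group_action \<Gamma> act"
    and "graph_relation G"
    and "analytic_set G"
    and "invariant_graph \<Gamma> act G"
    and "G \<subseteq> orbit_equivalence \<Gamma> act"
    and "analytic_set A"
  shows
    "(A \<in> anticlique_ideal G \<or>
       (\<exists>h :: (nat \<Rightarrow> bool) \<Rightarrow> 'a.
          continuous_on UNIV h \<and> inj h \<and> range h \<subseteq> A \<and> graph_homomorphism silver_graph G h)) \<and>
     \<not> (A \<in> anticlique_ideal G \<and>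
       (\<exists>h :: (nat \<Rightarrow> bool) \<Rightarrow> 'a.
          continuous_on UNIV h \<and> inj h \<and> range h \<subseteq> A \<and> graph_homomorphism silver_graph G h))"
proof (intro conjI)
  show "\<not> (A \<in> anticlique_ideal G \<and> (\<exists>h :: (nat \<Rightarrow> bool) \<Rightarrow> 'a.
      continuous_on UNIV h \<and> inj h \<and> range h \<subseteq> A \<and> graph_homomorphism silver_graph G h))"
    using silver_homomorphism_not_anticlique_ideal[of _ A G] by auto
  show "A \<in> anticlique_ideal G \<or> (\<exists>h :: (nat \<Rightarrow> bool) \<Rightarrow> 'a.
      continuous_on UNIV h \<and> inj h \<and> range h \<subseteq> A \<and> graph_homomorphism silver_graph G h)"
  proof (cases "A \<in> anticlique_ideal G")
    case A: False
    \<comment> \<open>Parametrisations exist only for nonempty analytic sets; an empty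
      \<open>A\<close> or an empty \<open>G\<close> would put \<open>A\<close> into the
      ideal.\<close>
    have "A \<noteq> {}"
      using A borel_anticlique_in_ideal[of "{}" G] by (auto simp: anticlique_def)
    then obtain f :: "(nat \<Rightarrow> nat) \<Rightarrow> 'a" where cont_f: "continuous_on UNIV f" and A_eq: "range f = A"
      using assms(8) unfolding analytic_set_def by blast
    have "G \<noteq> {}"
    proof
      assume "G = {}"
      then have "UNIV \<in> anticlique_ideal G"
        by (intro borel_anticlique_in_ideal) (simp_all add: anticlique_def)
      then show False
        using A anticlique_ideal_subset by blast
    qed
    then obtain g :: "(nat \<Rightarrow> nat) \<Rightarrow> 'a \<times> 'a" where g: "continuous_on UNIV g" "range g = G"
      using assms(5) unfolding analytic_set_def by blast
    interpret borel_covered_graph G "act ` carrier \<Gamma>" f g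
    proof
      show "sym G" "irrefl G"
        using assms(4) by (simp_all add: graph_relation_def)
      show "\<tau> \<in> borel_measurable borel" if "\<tau> \<in> act ` carrier \<Gamma>" for \<tau>
        using that measurable_action[OF assms(3)] by blast
      show "(\<tau> x, \<tau> y) \<in> G" if "\<tau> \<in> act ` carrier \<Gamma>" "(x, y) \<in> G" for \<tau> x y
        using that assms(6) unfolding invariant_graph_def by blast
      show "\<exists>\<tau>\<in>act ` carrier \<Gamma>. y = \<tau> x" if "(x, y) \<in> G" for x y
        using that assms(7) unfolding orbit_equivalence_def orbit_def by blast
    qed (use cont_f g assms(2) in auto)
    obtain h :: "(nat \<Rightarrow> bool) \<Rightarrow> 'a" where "continuous_on UNIV h" "inj h" "range h \<subseteq> A"
      "graph_homomorphism silver_graph G h"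
      using positive_imp_silver_homomorphism A unfolding A_eq by metis
    then show ?thesis
      by blast
  qed simp
qed

end
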